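(* Let $M\in\mathcal T$, let $M^*$ be its dual map and $v_0$ the root-vertex of $M^*$. The mapping $\Delta_M$ is a bijection from $\mathrm{Perc}_M$ to $\mathrm{DFS}_{M^*}$, and $\Lambda_M$ is the inverse bijection. Moreover, for any inner-coloring $\sigma^\circ\in\mathrm{Perc}_M$ and any site-percolation configuration $\sigma$ of $M$ which extends $\sigma^\circ$ (by attributing a color to the outer vertices) and satisfies the root-interface condition, the tree $\tau^*=\Delta_M(\sigma^\circ)$ satisfies: (i) the percolation path of $(M,\sigma)$ is contained in $\tau^*$; (ii) for any percolation cycle $C$ of $(M,\sigma)$, every edge of $C$ except one is in $\tau^*$; (iii) in the coloring of the faces of $M^*$ corresponding to $\sigma$, any edge of $\tau^*$ separating a black face and a white face of $M^*$ has the white face on its left when oriented from parent to child.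
   Context: A planar map is a proper embedding of a connected finite planar graph (loops and multiple edges allowed) in the sphere, up to orientation-preserving homeomorphism. A rooted map has a marked oriented root-edge; the face on its right is the root-face. Maps are drawn with the root-face as infinite face (so the root-edge goes counterclockwise around it). Vertices and edges incident to the root-face are outer, others inner; non-root faces are inner. A near-triangulation has all inner faces of degree 3. $\mathcal T$ is the set of rooted loopless near-triangulations with simple root-face boundary; by convention the map with one edge and two vertices is in $\mathcal T$. A site-percolation configuration is a black/white coloring of the vertices of $M$; it satisfies the root-interface condition if the root-edge goes from a white to a black vertex and no other outer edge goes from white to black in counterclockwise direction around the root-face. The dual $M^*$ has a vertex in each face of $M$ and an edge across each edge of $M$; $x^*$ denotes the dual of $x$. If $e_0$ is the root-edge of $M$, $M^*$ is rooted at $e_0^*$ oriented from the right to the left of $e_0$; its root-vertex $v_0$ is the dual of the root-face; all other vertices have degree 3. Vertex colorings of $M$ are face colorings of $M^*$. The percolation interfaces of $(M,\sigma)$ consist of the edges of $M^*$ separating faces of different colors and not incident to $v_0$; they form disjoint cycles (percolation cycles) and, under the root-interface condition, one path (the percolation path) starting at the inner triangle incident to $e_0$. If $T$ is a spanning tree of $M$, the duals of the edges not in $T$ form the dual spanning tree of $M^*$, and conversely. A depth-first search (DFS) of a connected graph $G$ starting at $v_0$: a chip starts at $v_0$, which is the only visited vertex; repeatedly, with the chip at $u$: (a) if there is an edge between $u$ and an unvisited vertex, choose such an edge $\{u,v\}$, move the chip to $v$, mark $v$ visited, call $u$ the parent of $v$ and $\{u,v\}$ the parent-edge of $v$; (b)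 otherwise the chip moves to the parent of $u$, or the DFS stops if $u=v_0$. The parent-edges form a spanning tree, called a $v_0$-DFS tree (equivalently: a spanning tree such that the endpoints of every edge of $G$ are comparable for the ancestor relation in the tree rooted at $v_0$). $\mathrm{Perc}_M$ is the set of inner-colorings of $M$, i.e. black/white colorings of the inner vertices. $\mathrm{DFS}_{M^*}$ is the set of $v_0$-DFS trees of $M^*$ containing the root-edge $e_0^*$. (For the one-edge map, $M^*$ is a loop and $\mathrm{DFS}_{M^*}$ is understood to consist of its unique spanning tree.) $\Delta_M$: for a visited vertex $v\ne v_0$ of $M^*$ with incident edges $e_1,e_2,e_3$ in clockwise order, $e_1$ being its parent-edge, $e_2$ is the left forward edge, $e_3$ the right forward edge, and the face containing the corner between $e_2$ and $e_3$ is the forward face of $v$. Given $\sigma^\circ\in\mathrm{Perc}_M$, color the faces of $M^*$ accordingly, the faces dual to outer vertices being white. $\Delta_M(\sigma^\circ)$ is the tree of the DFS of $M^*$ from $v_0$ that first moves along $e_0^*$ and subsequently, each time it is in case (a) at $u$ with several possible edges, moves along the left forward edge if the forward face of $u$ is black and along the right forward edge if it is white. $\Lambda_M$: given $\tau^*\in\mathrm{DFS}_{M^*}$, let $\tau$ be the dual spanning tree of $M$, rooted at the root-vertex (origin of the root-edge) of $M$. For an inner vertex $u$ of $M$, let $e$ be its parent-edge in $\tau$; $e^*\notin\tau^*$ joins a vertex $v_1$ to one of its descendants $v_2$ in $\tau^*$ (and $v_0,v_1,v_2$ are distinct). Color $u$ white if $e^*$ is on the left, at $v_1$, of the path of $\tau^*$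 from $v_0$ to $v_2$, and black otherwise. This defines the inner-coloring $\Lambda_M(\tau^* )$. *)

theory Defs
  imports
    "HOL-Combinatorics.Permutations"
    "HOL-Combinatorics.Orbits"
    "Graph_Theory.Arc_Walk"
    "Graph_Theory.Digraph_Component"
begin

section \<open>Rooted maps\<close>

text \<open>
  A map on an oriented surface, up to orientation-preserving homeomorphism, is encoded as a
  rotation system.  A dart is an oriented edge; \<open>flip\<close> reverses it; \<open>rot d\<close> is the next dart
  after \<open>d\<close> counterclockwise around the origin of \<open>d\<close>.  Vertices, edges and faces are
  represented by sets of darts: a vertex is the set of darts leaving it, an edge is the pair of
  its two orientations, and a face is the set of darts having this face on their right.
\<close>

record 'd rooted_map =
  darts :: "'d set"
  rot :: "'d \<Rightarrow> 'd"
  flip :: "'d \<Rightarrow> 'd"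
  root_dart :: "'d"

definition origin :: "'d rooted_map \<Rightarrow> 'd \<Rightarrow> 'd set" where
  "origin M d = orbit (rot M) d"

definition target :: "'d rooted_map \<Rightarrow> 'd \<Rightarrow> 'd set" where
  "target M d = origin M (flip M d)"

definition edge_of :: "'d rooted_map \<Rightarrow> 'd \<Rightarrow> 'd set" where
  "edge_of M d = {d, flip M d}"

text \<open>
  Arriving at the target of \<open>d\<close>, the next edge of the face on the right of \<open>d\<close> is the next one
  counterclockwise after \<open>flip d\<close>.
\<close>

definition face_perm :: "'d rooted_map \<Rightarrow> 'd \<Rightarrow> 'd" where
  "face_perm M = rot M \<circ> flip M"

definition right_face :: "'d rooted_map \<Rightarrow> 'd \<Rightarrow> 'd set" where
  "right_face M d = orbit (face_perm M) d"

definition left_face :: "'d rooted_map \<Rightarrow> 'd \<Rightarrow> 'd set" where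
  "left_face M d = right_face M (flip M d)"

definition vertex_set :: "'d rooted_map \<Rightarrow> 'd set set" where
  "vertex_set M = origin M ` darts M"

definition edge_set :: "'d rooted_map \<Rightarrow> 'd set set" where
  "edge_set M = edge_of M ` darts M"

definition face_set :: "'d rooted_map \<Rightarrow> 'd set set" where
  "face_set M = right_face M ` darts M"

text \<open>
  The graph with all the vertices of \<open>M\<close> but only the edges in \<open>S\<close>, both orientations of an edge
  being arcs.
\<close>

definition edge_graph :: "'d rooted_map \<Rightarrow> 'd set set \<Rightarrow> ('d set, 'd) pre_digraph" where
  "edge_graph M S = \<lparr> verts = vertex_set M, arcs = {d \<in> darts M. edge_of M d \<in> S},
     tail = origin M, head = target M \<rparr>"

definition rooted_planar_map :: "'d rooted_map \<Rightarrow> bool" where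
  "rooted_planar_map M \<longleftrightarrow>
     finite (darts M) \<and> root_dart M \<in> darts M \<and>
     rot M permutes darts M \<and> flip M permutes darts M \<and>
     (\<forall>d \<in> darts M. flip M d \<noteq> d \<and> flip M (flip M d) = d) \<and>
     strongly_connected (edge_graph M (edge_set M)) \<and>
     \<comment> \<open>genus zero\<close>
     card (vertex_set M) + card (face_set M) = card (edge_set M) + 2"

abbreviation root_vertex :: "'d rooted_map \<Rightarrow> 'd set" where
  "root_vertex M \<equiv> origin M (root_dart M)"

abbreviation root_edge :: "'d rooted_map \<Rightarrow> 'd set" where
  "root_edge M \<equiv> edge_of M (root_dart M)"

text \<open>
  The root-face is on the right of the root-edge.  Drawn as the infinite face, its darts run
  counterclockwise around it.
\<close>

abbreviation root_face :: "'d rooted_map \<Rightarrow> 'd set" where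
  "root_face M \<equiv> right_face M (root_dart M)"

definition outer_vertices :: "'d rooted_map \<Rightarrow> 'd set set" where
  "outer_vertices M = origin M ` root_face M"

definition inner_vertices :: "'d rooted_map \<Rightarrow> 'd set set" where
  "inner_vertices M = vertex_set M - outer_vertices M"

definition loopless :: "'d rooted_map \<Rightarrow> bool" where
  "loopless M \<longleftrightarrow> (\<forall>d \<in> darts M. origin M d \<noteq> target M d)"

definition near_triangulation :: "'d rooted_map \<Rightarrow> bool" where
  "near_triangulation M \<longleftrightarrow> (\<forall>f \<in> face_set M - {root_face M}. card f = 3)"

definition simple_root_boundary :: "'d rooted_map \<Rightarrow> bool" where
  "simple_root_boundary M \<longleftrightarrow>
     inj_on (origin M) (root_face M) \<and> inj_on (edge_of M) (root_face M)"

text \<open>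
  A loopless map with a single edge has two vertices; it belongs to the class by convention.
\<close>

definition single_edge :: "'d rooted_map \<Rightarrow> bool" where
  "single_edge M \<longleftrightarrow> card (edge_set M) = 1"

definition class_T :: "'d rooted_map \<Rightarrow> bool" where
  "class_T M \<longleftrightarrow> rooted_planar_map M \<and> loopless M \<and> near_triangulation M \<and>
     (simple_root_boundary M \<or> single_edge M)"


section \<open>The dual map\<close>

text \<open>
  The dual has the same darts: as a dart of the dual, \<open>d\<close> is the dual of \<open>d\<close> oriented from the
  right of \<open>d\<close> to the left of \<open>d\<close>.  As \<open>face_perm\<close> keeps the face on the right, it turns clockwise
  around that face, so that the counterclockwise rotation of the dual is its inverse.  The dual
  of an edge is the same set of two darts.
\<close>

definition dual :: "'d rooted_map \<Rightarrow> 'd rooted_map" where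
  "dual M = M\<lparr> rot := inv (face_perm M) \<rparr>"

text \<open>
  The face of the dual containing a vertex \<open>v\<close> of \<open>M\<close> is \<open>flip M ` v\<close>: the darts leaving \<open>v\<close> have
  this face on their left as darts of the dual.
\<close>

lemma origin_dual:
  assumes "rooted_planar_map M"
  shows "origin (dual M) d = right_face M d"
proof -
  have p: "face_perm M permutes darts M" and fin: "finite (darts M)"
    using assms by (auto simp: rooted_planar_map_def face_perm_def intro: permutes_compose)
  then have "permutation (face_perm M)"
    by (auto simp: permutation_permutes)
  then show ?thesis
    by (simp add: origin_def right_face_def dual_def orbit_inv_eq)
qed

lemma left_face_dual:
  assumes M: "rooted_planar_map M"
  shows "left_face (dual M) d = flip M ` origin M d"
proof -
  have r: "rot M permutes darts M" and f: "flip M permutes darts M" and fin: "finite (darts M)"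
    using M by (auto simp: rooted_planar_map_def)
  have ff: "flip M (flip M x) = x" for x
    using M f by (cases "x \<in> darts M") (auto simp: rooted_planar_map_def permutes_not_in)
  have invr: "inv (rot M) permutes darts M"
    using r by (rule permutes_inv)
  have invf: "inv (flip M) = flip M"
    by (rule inv_equality) (auto simp: ff)
  have "inv (face_perm M) = inv (flip M) \<circ> inv (rot M)"
    unfolding face_perm_def by (rule o_inv_distrib) (use r f permutes_bij in auto)
  then have fp: "face_perm (dual M) = flip M \<circ> inv (rot M) \<circ> flip M"
    by (simp add: face_perm_def dual_def invf)
  have pow: "((flip M \<circ> inv (rot M) \<circ> flip M) ^^ n) (flip M d) = flip M ((inv (rot M) ^^ n) d)" for n
    by (induction n) (auto simp: ff)
  have "left_face (dual M) d = flip M ` orbit (inv (rot M)) d"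
    unfolding left_face_def right_face_def fp
    by (auto simp: orbit_altdef pow dual_def)
  also have "orbit (inv (rot M)) d = orbit (rot M) d"
    using r fin by (intro orbit_inv_eq) (auto simp: permutation_permutes)
  finally show ?thesis by (simp add: origin_def)
qed

lemma right_face_dual:
  assumes M: "rooted_planar_map M"
  shows "right_face (dual M) d = flip M ` target M d"
proof -
  have f: "flip M permutes darts M"
    using M by (auto simp: rooted_planar_map_def)
  have "flip M (flip M d) = d"
    using M f by (cases "d \<in> darts M") (auto simp: rooted_planar_map_def permutes_not_in)
  then show ?thesis
    using left_face_dual[OF M, of "flip M d"] by (simp add: left_face_def target_def dual_def)
qed


section \<open>Colorings and percolation interfaces\<close>

datatype color = Black | White

definition Perc :: "'d rooted_map \<Rightarrow> ('d set \<Rightarrow> color) set" where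
  "Perc M = inner_vertices M \<rightarrow>\<^sub>E UNIV"

definition site_configurations :: "'d rooted_map \<Rightarrow> ('d set \<Rightarrow> color) set" where
  "site_configurations M = vertex_set M \<rightarrow>\<^sub>E UNIV"

definition extends_coloring ::
    "'d rooted_map \<Rightarrow> ('d set \<Rightarrow> color) \<Rightarrow> ('d set \<Rightarrow> color) \<Rightarrow> bool" where
  "extends_coloring M s c \<longleftrightarrow> (\<forall>v \<in> inner_vertices M. s v = c v)"

definition root_interface_condition :: "'d rooted_map \<Rightarrow> ('d set \<Rightarrow> color) \<Rightarrow> bool" where
  "root_interface_condition M s \<longleftrightarrow>
     s (root_vertex M) = White \<and> s (target M (root_dart M)) = Black \<and>
     (\<forall>d \<in> root_face M - {root_dart M}. \<not> (s (origin M d) = White \<and> s (target M d) = Black))"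

text \<open>The coloring of the faces of the dual corresponding to a coloring of the vertices.\<close>

definition face_coloring :: "'d rooted_map \<Rightarrow> ('d set \<Rightarrow> color) \<Rightarrow> 'd set \<Rightarrow> color" where
  "face_coloring M s F = s (flip M ` F)"

definition bicolored :: "'d rooted_map \<Rightarrow> ('d set \<Rightarrow> color) \<Rightarrow> 'd \<Rightarrow> bool" where
  "bicolored M s d \<longleftrightarrow>
     face_coloring M s (left_face (dual M) d) \<noteq> face_coloring M s (right_face (dual M) d)"

definition interface_edges :: "'d rooted_map \<Rightarrow> ('d set \<Rightarrow> color) \<Rightarrow> 'd set set" where
  "interface_edges M s = {edge_of (dual M) d | d. d \<in> darts (dual M) \<and> bicolored M s d \<and>
     origin (dual M) d \<noteq> root_vertex (dual M) \<and> target (dual M) d \<noteq> root_vertex (dual M)}"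

text \<open>
  The path starting at the triangle incident to the root-edge is a connected component of the
  graph of interface edges.  It is given by its set of edges, and is empty if no interface edge
  is incident to that triangle.
\<close>

definition percolation_path :: "'d rooted_map \<Rightarrow> ('d set \<Rightarrow> color) \<Rightarrow> 'd set set" where
  "percolation_path M s = {edge_of (dual M) d | d p v.
     pre_digraph.awalk (edge_graph (dual M) (interface_edges M s)) (left_face M (root_dart M)) p v \<and>
     d \<in> set p}"

text \<open>
  The library's cycles are directed, so \<open>[d, flip M d]\<close>, which is not a cycle of the undirected
  graph, has to be excluded.
\<close>

definition undirected_cycle :: "'d rooted_map \<Rightarrow> 'd set set \<Rightarrow> 'd list \<Rightarrow> bool" where
  "undirected_cycle G S p \<longleftrightarrow> pre_digraph.cycle (edge_graph G S) p \<and> distinct (map (edge_of G) p)"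

definition percolation_cycles :: "'d rooted_map \<Rightarrow> ('d set \<Rightarrow> color) \<Rightarrow> 'd set set set" where
  "percolation_cycles M s =
     {edge_of (dual M) ` set p | p. undirected_cycle (dual M) (interface_edges M s) p}"


section \<open>Spanning trees and depth-first search\<close>

definition spanning_tree_of :: "'d rooted_map \<Rightarrow> 'd set set \<Rightarrow> bool" where
  "spanning_tree_of G T \<longleftrightarrow> T \<subseteq> edge_set G \<and> strongly_connected (edge_graph G T) \<and>
     (\<nexists>p. undirected_cycle G T p)"

text \<open>In the tree \<open>T\<close> rooted at \<open>r\<close>, the dart \<open>d\<close> goes from the parent of its target to its target.\<close>

definition tree_dart :: "'d rooted_map \<Rightarrow> 'd set set \<Rightarrow> 'd set \<Rightarrow> 'd \<Rightarrow> bool" where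
  "tree_dart G T r d \<longleftrightarrow> (\<exists>p. pre_digraph.apath (edge_graph G T) r (p @ [d]) (target G d))"

definition forward_darts :: "'d rooted_map \<Rightarrow> 'd set set \<Rightarrow> 'd set \<Rightarrow> 'd set" where
  "forward_darts G X u = {d \<in> darts G. origin G d = u \<and> target G d \<notin> X}"

text \<open>
  States \<open>(u, X, P)\<close> that a depth-first search can reach: the chip is at \<open>u\<close>, \<open>X\<close> is the set of
  visited vertices, and \<open>P\<close> maps every visited vertex other than \<open>r\<close> to its parent-edge, oriented
  from parent to child.  The predicate \<open>allowed\<close> restricts the choices made in case (a).
\<close>

inductive dfs_reaches ::
    "'d rooted_map \<Rightarrow> 'd set \<Rightarrow> ('d set \<Rightarrow> 'd set set \<Rightarrow> ('d set \<rightharpoonup> 'd) \<Rightarrow> 'd \<Rightarrow> bool) \<Rightarrow>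
     'd set \<Rightarrow> 'd set set \<Rightarrow> ('d set \<rightharpoonup> 'd) \<Rightarrow> bool"
  for G r allowed where
  start: "dfs_reaches G r allowed r {r} Map.empty"
| forward: "dfs_reaches G r allowed u X P \<Longrightarrow> d \<in> forward_darts G X u \<Longrightarrow> allowed u X P d \<Longrightarrow>
    dfs_reaches G r allowed (target G d) (insert (target G d) X) (P(target G d \<mapsto> d))"
| backward: "dfs_reaches G r allowed u X P \<Longrightarrow> forward_darts G X u = {} \<Longrightarrow> u \<noteq> r \<Longrightarrow> P u = Some d \<Longrightarrow>
    dfs_reaches G r allowed (origin G d) X P"

definition dfs_trees ::
    "'d rooted_map \<Rightarrow> 'd set \<Rightarrow> ('d set \<Rightarrow> 'd set set \<Rightarrow> ('d set \<rightharpoonup> 'd) \<Rightarrow> 'd \<Rightarrow> bool) \<Rightarrow>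
     'd set set set" where
  "dfs_trees G r allowed = {edge_of G ` ran P | X P.
     dfs_reaches G r allowed r X P \<and> forward_darts G X r = {}}"

text \<open>
  The dual of the single-edge map is a loop, which belongs to no depth-first search tree.
\<close>

definition DFS :: "'d rooted_map \<Rightarrow> 'd set set set" where
  "DFS M =
     (if single_edge M then {T. spanning_tree_of (dual M) T}
      else {T \<in> dfs_trees (dual M) (root_vertex (dual M)) (\<lambda>_ _ _ _. True). root_edge (dual M) \<in> T})"


section \<open>The mapping from inner colorings to depth-first search trees\<close>

text \<open>
  Here \<open>p\<close> is the parent-edge of a vertex \<open>v\<close> of degree three, oriented towards \<open>v\<close>; the forward
  edges are oriented away from \<open>v\<close>.  The three edges in clockwise order are \<open>flip G p\<close>, the left
  and the right forward edge; the forward face, between the last two, is on the right of the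
  left one.
\<close>

definition left_forward :: "'d rooted_map \<Rightarrow> 'd \<Rightarrow> 'd" where
  "left_forward G p = inv (rot G) (flip G p)"

definition right_forward :: "'d rooted_map \<Rightarrow> 'd \<Rightarrow> 'd" where
  "right_forward G p = inv (rot G) (left_forward G p)"

definition forward_face :: "'d rooted_map \<Rightarrow> 'd \<Rightarrow> 'd set" where
  "forward_face G p = right_face G (left_forward G p)"

definition outer_white :: "'d rooted_map \<Rightarrow> ('d set \<Rightarrow> color) \<Rightarrow> 'd set \<Rightarrow> color" where
  "outer_white M c v = (if v \<in> inner_vertices M then c v else White)"

text \<open>At the start \<open>X = {v\<^sub>0}\<close>, and the search has to move along the dual of the root-edge.\<close>

definition Delta_choice ::
    "'d rooted_map \<Rightarrow> ('d set \<Rightarrow> color) \<Rightarrow> 'd set \<Rightarrow> 'd set set \<Rightarrow> ('d set \<rightharpoonup> 'd) \<Rightarrow> 'd \<Rightarrow> bool" where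
  "Delta_choice M c u X P d \<longleftrightarrow>
     (X = {root_vertex (dual M)} \<longrightarrow> d = root_dart (dual M)) \<and>
     (u \<noteq> root_vertex (dual M) \<and> card (forward_darts (dual M) X u) \<ge> 2 \<longrightarrow>
       d = (case face_coloring M (outer_white M c) (forward_face (dual M) (the (P u))) of
              Black \<Rightarrow> left_forward (dual M) (the (P u))
            | White \<Rightarrow> right_forward (dual M) (the (P u))))"

definition Delta :: "'d rooted_map \<Rightarrow> ('d set \<Rightarrow> color) \<Rightarrow> 'd set set" where
  "Delta M c = (THE T. T \<in> dfs_trees (dual M) (root_vertex (dual M)) (Delta_choice M c))"


section \<open>The mapping from depth-first search trees to inner colorings\<close>

text \<open>An edge and its dual being the same set, this is also the dual of a spanning tree of \<open>M\<close>.\<close>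

definition dual_tree :: "'d rooted_map \<Rightarrow> 'd set set \<Rightarrow> 'd set set" where
  "dual_tree M T = edge_set M - T"

text \<open>
  The path from \<open>r\<close> to the target of \<open>d\<close> in the tree \<open>T\<close> visits the origin of \<open>d\<close>, entering it by
  \<open>a\<close> and leaving it by \<open>b\<close>, and \<open>d\<close> is on the left of this path there.  The origin having
  degree three, being on the left means that its edges are \<open>flip G a\<close>, \<open>d\<close>, \<open>b\<close> in clockwise order.
\<close>

definition left_of_tree_path :: "'d rooted_map \<Rightarrow> 'd set set \<Rightarrow> 'd set \<Rightarrow> 'd \<Rightarrow> bool" where
  "left_of_tree_path G T r d \<longleftrightarrow>
     (\<exists>ps a b qs. pre_digraph.apath (edge_graph G T) r (ps @ [a, b] @ qs) (target G d) \<and>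
        target G a = origin G d \<and> inv (rot G) (flip G a) = d \<and> inv (rot G) d = b)"

text \<open>
  Below, \<open>d\<close> is the parent-edge of \<open>u\<close> in the dual tree.  Its dual can be read with either
  orientation \<open>d'\<close>; only the one from the ancestor to the descendant can satisfy
  \<open>left_of_tree_path\<close>.
\<close>

definition Lambda :: "'d rooted_map \<Rightarrow> 'd set set \<Rightarrow> 'd set \<Rightarrow> color" where
  "Lambda M T = (\<lambda>u \<in> inner_vertices M.
     if \<exists>d d'. tree_dart M (dual_tree M T) (root_vertex M) d \<and> target M d = u \<and>
          d' \<in> edge_of M d \<and> left_of_tree_path (dual M) T (root_vertex (dual M)) d'
     then White else Black)"

end

theory Submission
  imports Defs
begin

text \<open>
  Everything is deduced from conservation of flows.  A set \<open>A\<close> of vertices of the map defines a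
  flow on its dual, which crosses an edge according to whether the edge leaves or enters \<open>A\<close>; since
  a face is surrounded by a closed walk, nothing is lost at any dual vertex
  (\<open>circulation_vertex_flow\<close>).  In a spanning tree of the dual, conservation in the subtree below
  an edge says that the flow through this edge is what leaves the subtree through edges outside
  the tree (\<open>circulation_subtree\<close>).  In a depth-first search tree, the edges outside the tree, here
  called chords, join a vertex to one of its descendants, so these are the chords going up from
  the subtree to an ancestor.

  The bijection rests on one topological fact (\<open>chord_forward_face\<close>).  Let the chord \<open>b\<close> have its
  top at a triangle \<open>v \<noteq> v\<^sub>0\<close>, and let it be dual to the parent edge of \<open>x\<close> in the complementary tree
  of the map.  Then \<open>x\<close> is the forward face of \<open>v\<close>.  For the subtree at \<open>x\<close> defines a flow carried
  by the search tree and \<open>b\<close>; both ends of \<open>b\<close> are below every ancestor of \<open>v\<close>, so no flow passes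
  through the tree edges from \<open>v\<^sub>0\<close> to \<open>v\<close>.  Hence all the faces along this path, in particular
  those on both sides of the parent edge of \<open>v\<close>, are outside the subtree at \<open>x\<close>, like the root-vertex.

  When a search directed by a coloring reaches \<open>v\<close>, the bottom of the chord is still unvisited, and
  so is the child of \<open>v\<close> above it.  Both forward darts are possible, and the color of the forward
  face \<open>x\<close> decides on which side of the path the chord \<open>b\<close> is left.  This gives \<open>\<Lambda> \<circ> \<Delta> = id\<close>
  (\<open>Lambda_of_delta_tree\<close>).  Conversely the search directed by \<open>\<Lambda>(\<tau>)\<close> never uses a chord of \<open>\<tau>\<close>
  (\<open>Delta_choice_in_tree\<close>), which gives \<open>\<Delta> \<circ> \<Lambda> = id\<close>.  The complementary tree is provided by
  Euler's formula, and the simplicity of the boundary makes \<open>v\<^sub>0\<close> a leaf of the search tree.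

  For the interfaces, take the flow of the white vertices.  By the position of the forward faces
  and by the root-interface condition it never goes down along a chord; so it never goes up along
  a tree edge, which is (iii).  At the top \<open>v\<close> of an interface chord, the interface arrives along
  the chord and leaves downward, so the parent edge of \<open>v\<close> carries no flow.  As nothing flows down
  a chord, no interface edge at all leaves the subtree at \<open>v\<close> (\<open>chord_confines_interface\<close>).  On
  the percolation path there is no such \<open>v\<close>: the path starts at the child of \<open>v\<^sub>0\<close>, whose parent
  edge, the dual of the root-edge, is bicolored.  Two chords of a percolation cycle must have the
  same top, hence coincide; a cycle without chords cannot exist in a tree.
\<close>

section \<open>Circulations and rooted trees\<close>

lemma sum_orbit_shift:
  fixes g :: "'a \<Rightarrow> int"
  assumes "permutation f"
  shows "(\<Sum>x\<in>orbit f a. g (f x)) = (\<Sum>x\<in>orbit f a. g x)"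
proof -
  have inj: "inj_on f (orbit f a)"
    using assms by (meson bij_is_inj permutation_bijective inj_on_subset subset_UNIV)
  moreover have "f ` orbit f a = orbit f a"
    using inj by (intro endo_inj_surj finite_orbit permutation_self_in_orbit assms)
      (auto intro: orbit.step)
  ultimately have "bij_betw f (orbit f a) (orbit f a)"
    by (simp add: bij_betw_def)
  then show ?thesis
    by (rule sum.reindex_bij_betw)
qed

locale dart_graph =
  fixes G :: "'d rooted_map"
  assumes finite_darts [simp, intro]: "finite (darts G)"
    and flip_in [simp]: "flip G d \<in> darts G \<longleftrightarrow> d \<in> darts G"
    and flip_flip [simp]: "flip G (flip G d) = d"
begin

lemma target_flip [simp]: "target G (flip G d) = origin G d"
  by (simp add: target_def)

lemma origin_flip [simp]: "origin G (flip G d) = target G d"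
  by (simp add: target_def)

lemma edge_of_flip [simp]: "edge_of G (flip G d) = edge_of G d"
  by (auto simp: edge_of_def)

lemma edge_of_eq_iff: "edge_of G d = edge_of G d' \<longleftrightarrow> d' = d \<or> d' = flip G d"
  unfolding edge_of_def doubleton_eq_iff by (metis flip_flip)

lemma origin_in_vertices [simp]: "d \<in> darts G \<Longrightarrow> origin G d \<in> vertex_set G"
  by (simp add: vertex_set_def)

lemma target_in_vertices [simp]: "d \<in> darts G \<Longrightarrow> target G d \<in> vertex_set G"
  using origin_in_vertices[of "flip G d"] by simp

lemma edge_of_in_edges [simp]: "d \<in> darts G \<Longrightarrow> edge_of G d \<in> edge_set G"
  by (simp add: edge_set_def)

lemma finite_vertices [simp]: "finite (vertex_set G)"
  by (simp add: vertex_set_def)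

lemma finite_edges [simp]: "finite (edge_set G)"
  by (simp add: edge_set_def)

text \<open>
  A circulation is an antisymmetric function on the darts satisfying Kirchhoff's law at every
  vertex.
\<close>

definition circulation :: "('d \<Rightarrow> int) \<Rightarrow> bool" where
  "circulation \<phi> \<longleftrightarrow> (\<forall>d \<in> darts G. \<phi> (flip G d) = - \<phi> d) \<and>
     (\<forall>v \<in> vertex_set G. (\<Sum>d | d \<in> darts G \<and> origin G d = v. \<phi> d) = 0)"

lemma circulation_flip: "circulation \<phi> \<Longrightarrow> d \<in> darts G \<Longrightarrow> \<phi> (flip G d) = - \<phi> d"
  by (simp add: circulation_def)

lemma circulation_cut:
  assumes "circulation \<phi>"
  shows "(\<Sum>d | d \<in> darts G \<and> origin G d \<in> S \<and> target G d \<notin> S. \<phi> d) = 0"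
proof -
  let ?O = "{d \<in> darts G. origin G d \<in> S}"
  let ?I = "{d \<in> darts G. origin G d \<in> S \<and> target G d \<in> S}"
  let ?C = "{d \<in> darts G. origin G d \<in> S \<and> target G d \<notin> S}"
  have "sum \<phi> ?O = (\<Sum>v\<in>vertex_set G. \<Sum>d\<in>{d\<in>?O. origin G d = v}. \<phi> d)"
    by (rule sum.group[symmetric]) auto
  also have "\<dots> = 0"
  proof (rule sum.neutral, rule ballI)
    fix v assume v: "v \<in> vertex_set G"
    have "{d\<in>?O. origin G d = v} = (if v \<in> S then {d \<in> darts G. origin G d = v} else {})"
      by auto
    then show "(\<Sum>d\<in>{d\<in>?O. origin G d = v}. \<phi> d) = 0"
      using assms v by (simp add: circulation_def)
  qed
  finally have "sum \<phi> ?O = 0" .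
  moreover have "sum \<phi> ?O = sum \<phi> ?I + sum \<phi> ?C"
    by (subst sum.union_disjoint[symmetric]) (auto intro: sum.cong)
  \<comment> \<open>inside \<open>S\<close> the two orientations of an edge cancel\<close>
  moreover have "sum \<phi> ?I = (\<Sum>d\<in>?I. \<phi> (flip G d))"
    by (rule sum.reindex_bij_witness[of _ "flip G" "flip G"]) auto
  then have "sum \<phi> ?I = - sum \<phi> ?I"
    using assms by (simp add: circulation_flip sum_negf)
  ultimately show ?thesis by simp
qed

abbreviation walk :: "'d set set \<Rightarrow> 'd set \<Rightarrow> 'd list \<Rightarrow> 'd set \<Rightarrow> bool" where
  "walk S \<equiv> pre_digraph.awalk (edge_graph G S)"

abbreviation walk_verts :: "'d set set \<Rightarrow> 'd set \<Rightarrow> 'd list \<Rightarrow> 'd set list" where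
  "walk_verts S \<equiv> pre_digraph.awalk_verts (edge_graph G S)"

abbreviation path :: "'d set set \<Rightarrow> 'd set \<Rightarrow> 'd list \<Rightarrow> 'd set \<Rightarrow> bool" where
  "path S \<equiv> pre_digraph.apath (edge_graph G S)"

lemma walk_Nil [simp]: "walk S u [] v \<longleftrightarrow> u = v \<and> u \<in> vertex_set G"
  by (auto simp: pre_digraph.awalk_def pre_digraph.cas.simps edge_graph_def)

lemma walk_Cons [simp]:
  "walk S u (d # p) v \<longleftrightarrow>
     d \<in> darts G \<and> edge_of G d \<in> S \<and> origin G d = u \<and> walk S (target G d) p v"
  by (auto simp: pre_digraph.awalk_def pre_digraph.cas.simps edge_graph_def)

lemma walk_append: "walk S u (p @ q) v \<longleftrightarrow> (\<exists>w. walk S u p w \<and> walk S w q v)"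
proof (induction p arbitrary: u)
  case Nil
  have "walk S u q v \<Longrightarrow> u \<in> vertex_set G"
    by (cases q) auto
  then show ?case by auto
qed auto

lemma walk_verts_simps [simp]:
  "walk_verts S u [] = [u]"
  "walk_verts S u (d # p) = origin G d # walk_verts S (target G d) p"
  by (simp_all add: pre_digraph.awalk_verts.simps edge_graph_def)

lemma walk_dart: "walk S u p v \<Longrightarrow> d \<in> set p \<Longrightarrow> d \<in> darts G \<and> edge_of G d \<in> S"
  by (induction p arbitrary: u) auto

lemma walk_verts_snoc:
  "walk S u (p @ [d]) v \<Longrightarrow> walk_verts S u (p @ [d]) = walk_verts S u p @ [v]"
  by (induction p arbitrary: u) auto

lemma origin_in_walk_verts: "d \<in> set p \<Longrightarrow> origin G d \<in> set (walk_verts S u p)"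
  by (induction p arbitrary: u) auto

text \<open>
  The increments telescope.  With \<open>f\<close> the indicator of a set, a closed walk enters the set as often
  as it leaves it.
\<close>

lemma walk_increments:
  fixes f :: "'d set \<Rightarrow> int"
  assumes "walk S u p v"
  shows "(\<Sum>d\<leftarrow>p. f (target G d) - f (origin G d)) = f v - f u"
  using assms by (induction p arbitrary: u) auto

end

definition parent_rel :: "'d rooted_map \<Rightarrow> ('d set \<rightharpoonup> 'd) \<Rightarrow> ('d set \<times> 'd set) set" where
  "parent_rel G P = {(origin G d, v) | v d. P v = Some d}"

definition descends :: "'d rooted_map \<Rightarrow> ('d set \<rightharpoonup> 'd) \<Rightarrow> 'd set \<Rightarrow> 'd set \<Rightarrow> bool" where
  "descends G P u v \<longleftrightarrow> (u, v) \<in> (parent_rel G P)\<^sup>*"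

lemma descends_refl [simp]: "descends G P u u"
  by (simp add: descends_def)

lemma descends_trans: "descends G P u v \<Longrightarrow> descends G P v w \<Longrightarrow> descends G P u w"
  unfolding descends_def by (rule rtrancl_trans)

lemma descends_parent: "P v = Some d \<Longrightarrow> descends G P (origin G d) v"
  unfolding descends_def parent_rel_def by auto

lemma descends_step_iff:
  assumes "P v = Some d"
  shows "descends G P u v \<longleftrightarrow> u = v \<or> descends G P u (origin G d)"
proof
  assume "descends G P u v"
  then have "(u, v) \<in> (parent_rel G P)\<^sup>*"
    by (simp add: descends_def)
  then show "u = v \<or> descends G P u (origin G d)"
  proof (cases rule: rtranclE)
    case (step y)
    then have "y = origin G d"
      using assms by (auto simp: parent_rel_def)
    then show ?thesis using step by (simp add: descends_def)
  qed simp
next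
  show "u = v \<or> descends G P u (origin G d) \<Longrightarrow> descends G P u v"
    using descends_parent[of P v d G, OF assms] descends_trans[of G P u "origin G d" v] by auto
qed

lemma descends_None_iff: "P v = None \<Longrightarrow> descends G P u v \<longleftrightarrow> u = v"
  unfolding descends_def by (auto elim: rtranclE simp: parent_rel_def)

text \<open>
  A tree grown from \<open>r\<close>, given by the parent darts of its vertices other than \<open>r\<close>.  It need not
  span \<open>G\<close>: the states of a depth-first search are trees in this sense.
\<close>

locale rooted_tree = dart_graph G for G :: "'d rooted_map" +
  fixes r :: "'d set" and P :: "'d set \<rightharpoonup> 'd"
  assumes root_in: "r \<in> vertex_set G"
    and root_None: "P r = None"
    and parent_dart: "P v = Some d \<Longrightarrow> d \<in> darts G"
    and parent_target: "P v = Some d \<Longrightarrow> target G d = v"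
    and parent_origin: "P v = Some d \<Longrightarrow> origin G d \<in> insert r (dom P)"
    and depth_exists: "\<exists>\<delta> :: 'd set \<Rightarrow> nat. \<forall>v d. P v = Some d \<longrightarrow> \<delta> (origin G d) < \<delta> v"
begin

abbreviation desc :: "'d set \<Rightarrow> 'd set \<Rightarrow> bool" where
  "desc \<equiv> descends G P"

abbreviation tree_edges :: "'d set set" where
  "tree_edges \<equiv> edge_of G ` ran P"

definition depth :: "'d set \<Rightarrow> nat" where
  "depth = (SOME \<delta>. \<forall>v d. P v = Some d \<longrightarrow> \<delta> (origin G d) < \<delta> v)"

lemma depth_parent: "P v = Some d \<Longrightarrow> depth (origin G d) < depth v"
  using someI_ex[OF depth_exists] unfolding depth_def by blast

lemma desc_depth: "desc u v \<Longrightarrow> u = v \<or> depth u < depth v"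
  unfolding descends_def
  by (induction rule: rtrancl_induct) (auto simp: parent_rel_def dest!: depth_parent)

lemma desc_antisym: "desc u v \<Longrightarrow> desc v u \<Longrightarrow> u = v"
  by (metis desc_depth less_asym)

lemma parent_not_below: "P v = Some d \<Longrightarrow> \<not> desc v (origin G d)"
  by (metis desc_depth depth_parent less_asym)

lemma desc_in: "desc u v \<Longrightarrow> v \<in> insert r (dom P) \<Longrightarrow> u \<in> insert r (dom P)"
  unfolding descends_def
proof (induction rule: converse_rtrancl_induct)
  case (step u u')
  then show ?case
    using parent_origin by (auto simp: parent_rel_def)
qed

lemma desc_root_iff: "desc u r \<longleftrightarrow> u = r"
  by (rule descends_None_iff) (rule root_None)

lemma root_desc: "v \<in> insert r (dom P) \<Longrightarrow> desc r v"
proof (induction "depth v" arbitrary: v rule: less_induct)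
  case less
  show ?case
  proof (cases "v = r")
    case False
    with less obtain d where d: "P v = Some d" by auto
    then show ?thesis
      using less(1)[OF depth_parent[OF d] parent_origin[OF d]] by (simp add: descends_step_iff)
  qed simp
qed

lemma desc_child:
  assumes "desc u v" "u \<noteq> v"
  obtains d where "P (target G d) = Some d" "origin G d = u" "desc (target G d) v"
proof -
  obtain w where "(u, w) \<in> parent_rel G P" and w: "desc w v"
    using assms unfolding descends_def by (metis converse_rtranclE)
  then obtain d where d: "P w = Some d" "origin G d = u"
    by (auto simp: parent_rel_def)
  with w show ?thesis
    using that parent_target by blast
qed

lemma desc_comparable:
  assumes "desc u w" "desc v w"
  shows "desc u v \<or> desc v u"
  using assms(1) unfolding descends_def[of _ _ u w]
proof (induction rule: converse_rtrancl_induct)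
  case base
  show ?case using assms by simp
next
  case (step u u')
  then obtain d where "P u' = Some d" "origin G d = u" by (auto simp: parent_rel_def)
  with step show ?case
    using descends_step_iff[of P u' d G v] descends_parent[of P u' d G] descends_trans[of G P u u' v]
    by auto
qed

lemma tree_edge_cases:
  assumes "edge_of G d \<in> tree_edges"
  obtains "P (target G d) = Some d" | "P (origin G d) = Some (flip G d)"
  using assms parent_target by (auto simp: ran_def edge_of_eq_iff) (metis target_flip)+

lemma parent_edge_inj:
  assumes "P v = Some d" "P w = Some e" "edge_of G d = edge_of G e"
  shows "v = w"
proof (rule ccontr)
  \<comment> \<open>otherwise each of the two vertices would be the parent of the other\<close>
  assume "v \<noteq> w"
  with assms have "e = flip G d"
    using parent_target by (auto simp: edge_of_eq_iff)
  then have "origin G e = v" "origin G d = w"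
    using assms(1,2) parent_target by (metis origin_flip, metis target_flip)
  then show False
    using depth_parent[OF assms(1)] depth_parent[OF assms(2)] by simp
qed

lemma card_tree_edges: "card tree_edges = card (dom P)"
proof -
  have "tree_edges = (edge_of G \<circ> the \<circ> P) ` dom P"
    by (force simp: ran_def dom_def image_iff)
  moreover have "inj_on (edge_of G \<circ> the \<circ> P) (dom P)"
    by (rule inj_onI) (use parent_edge_inj in force)
  ultimately show ?thesis
    by (metis card_image)
qed

text \<open>
  This single crossing is what makes flows and closed walks computable subtree by subtree.
\<close>

lemma tree_edge_leaving_subtree:
  assumes "edge_of G d \<in> tree_edges" "desc y (origin G d)" "\<not> desc y (target G d)"
  shows "P y = Some (flip G d)"
  using assms(1)
proof (cases rule: tree_edge_cases)
  case 1
  then show ?thesis using assms by (simp add: descends_step_iff)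
next
  case 2
  then show ?thesis using assms descends_step_iff[of P "origin G d" "flip G d" G y] by auto
qed

text \<open>
  This is conservation in the subtree below \<open>y\<close>, which the tree joins to the rest by \<open>d\<close> only.
\<close>

lemma circulation_subtree:
  assumes \<phi>: "circulation \<phi>" and d: "P y = Some d"
  shows "\<phi> d = (\<Sum>e | e \<in> darts G \<and> desc y (origin G e) \<and> \<not> desc y (target G e) \<and>
                        edge_of G e \<notin> tree_edges. \<phi> e)"
proof -
  let ?C = "{e \<in> darts G. desc y (origin G e) \<and> \<not> desc y (target G e)}"
  have mem: "flip G d \<in> ?C"
    using parent_dart[OF d] parent_target[OF d] parent_not_below[OF d] by simp
  have "sum \<phi> ?C = 0"
    using circulation_cut[OF \<phi>, of "{v. desc y v}"] by simp
  moreover have "sum \<phi> ?C = \<phi> (flip G d) + sum \<phi> (?C - {flip G d})"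
    using mem by (intro sum.remove) auto
  moreover have "edge_of G e \<in> tree_edges \<longleftrightarrow> e = flip G d" if "e \<in> ?C" for e
  proof
    assume "edge_of G e \<in> tree_edges"
    then have "P y = Some (flip G e)"
      using tree_edge_leaving_subtree that by blast
    with d show "e = flip G d" by auto
  next
    assume "e = flip G d"
    then show "edge_of G e \<in> tree_edges"
      using d by (auto simp: ran_def)
  qed
  then have "?C - {flip G d} = {e \<in> darts G. desc y (origin G e) \<and> \<not> desc y (target G e) \<and>
                        edge_of G e \<notin> tree_edges}"
    by blast
  ultimately show ?thesis
    using circulation_flip[OF \<phi> parent_dart[OF d]] by simp
qed

lemma circulation_supported_on_tree:
  assumes \<phi>: "circulation \<phi>"
    and supp: "\<And>e. e \<in> darts G \<Longrightarrow> edge_of G e \<notin> tree_edges \<Longrightarrow> \<phi> e = 0"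
    and d: "d \<in> darts G"
  shows "\<phi> d = 0"
proof (cases "edge_of G d \<in> tree_edges")
  case True
  have "\<phi> e = 0" if "P y = Some e" for y e
    unfolding circulation_subtree[OF \<phi> that] by (intro sum.neutral) (use supp in auto)
  with True show ?thesis
    using circulation_flip[OF \<phi> d] by (cases rule: tree_edge_cases) auto
qed (use supp d in simp)

text \<open>
  A tree edge taken upward would be the one by which the path has just come down.
\<close>

lemma path_from_root_down:
  assumes "path tree_edges r p v" "d \<in> set p"
  shows "P (target G d) = Some d"
  using assms
proof (induction p arbitrary: v d rule: rev_induct)
  case (snoc e p)
  have w: "walk tree_edges r (p @ [e]) v"
    and dist: "distinct (walk_verts tree_edges r (p @ [e]))"
    using snoc.prems by (auto simp: pre_digraph.apath_def)
  obtain u where u: "walk tree_edges r p u" "origin G e = u" "target G e = v"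
    "e \<in> darts G" "edge_of G e \<in> tree_edges"
    using w by (auto simp: walk_append)
  have verts: "walk_verts tree_edges r (p @ [e]) = walk_verts tree_edges r p @ [v]"
    using walk_verts_snoc[OF w] .
  have p: "path tree_edges r p u"
    using u dist verts by (simp add: pre_digraph.apath_def)
  have "P (target G e) = Some e"
    using u(5)
  proof (cases rule: tree_edge_cases)
    case 2
    show ?thesis
    proof (cases p rule: rev_cases)
      case Nil
      then show ?thesis using u 2 root_None by simp
    next
      case (snoc q a)
      then have "target G a = u"
        using u(1) by (auto simp: walk_append)
      moreover have "P (target G a) = Some a"
        using snoc.IH[OF p] snoc by simp
      ultimately have "a = flip G e"
        using 2 u(2) by simp
      then have "v = origin G a"
        using u(3) by simp
      then have "v \<in> set (walk_verts tree_edges r p)"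
        using origin_in_walk_verts[of a p] snoc by simp
      then show ?thesis
        using dist verts by simp
    qed
  qed
  then show ?case
    using snoc.IH[OF p] snoc.prems(2) by auto
qed simp

lemma down_walk_desc:
  assumes "walk S u p v" "\<forall>d \<in> set p. P (target G d) = Some d" "x \<in> set (walk_verts S u p)"
  shows "desc u x"
  using assms
proof (induction p arbitrary: u)
  case (Cons d p)
  then have "desc (origin G d) (target G d)"
    using descends_parent[of P "target G d" d G] by simp
  then show ?case
    using Cons descends_trans by fastforce
qed simp

lemma down_walk_path:
  assumes "walk S u p v" "\<forall>d \<in> set p. P (target G d) = Some d"
  shows "path S u p v"
  using assms
proof (induction p arbitrary: u)
  case (Cons d p)
  then have p: "path S (target G d) p v" "walk S (target G d) p v" and d: "P (target G d) = Some d"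
    by auto
  have "origin G d \<notin> set (walk_verts S (target G d) p)"
    using down_walk_desc[OF p(2)] Cons.prems(2) parent_not_below[OF d] by auto
  then show ?case
    using Cons.prems p by (simp add: pre_digraph.apath_def)
qed (auto simp: pre_digraph.apath_def)

lemma desc_down_walk:
  assumes "desc u v" "u \<in> vertex_set G"
  obtains p where "walk tree_edges u p v" "\<forall>d \<in> set p. P (target G d) = Some d"
proof -
  have "\<exists>p. walk tree_edges u p v \<and> (\<forall>d \<in> set p. P (target G d) = Some d)"
    using assms(1) unfolding descends_def
  proof (induction rule: rtrancl_induct)
    case base
    show ?case using assms(2) by (intro exI[of _ "[]"]) simp
  next
    case (step w x)
    then obtain p where p: "walk tree_edges u p w" "\<forall>d \<in> set p. P (target G d) = Some d"
      by blast
    from step obtain d where d: "P x = Some d" "origin G d = w"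
      by (auto simp: parent_rel_def)
    then have "target G d = x" "d \<in> darts G" "edge_of G d \<in> tree_edges"
      using parent_target parent_dart by (auto simp: ran_def)
    with p d show ?case
      by (intro exI[of _ "p @ [d]"]) (auto simp: walk_append)
  qed
  then show ?thesis using that by blast
qed

lemma in_vertices: "v \<in> insert r (dom P) \<Longrightarrow> v \<in> vertex_set G"
  using root_in parent_dart parent_target target_in_vertices by blast

lemma tree_dart_iff: "tree_dart G tree_edges r d \<longleftrightarrow> P (target G d) = Some d"
proof
  assume "tree_dart G tree_edges r d"
  then show "P (target G d) = Some d"
    unfolding tree_dart_def using path_from_root_down by fastforce
next
  assume d: "P (target G d) = Some d"
  then obtain p where p: "walk tree_edges r p (origin G d)" "\<forall>d \<in> set p. P (target G d) = Some d"
    using desc_down_walk[OF root_desc[OF parent_origin[OF d]] root_in] by blast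
  have "edge_of G d \<in> tree_edges"
    using d by (auto simp: ran_def)
  then have "path tree_edges r (p @ [d]) (target G d)"
    using p d parent_dart[OF d] by (intro down_walk_path) (auto simp: walk_append)
  then show "tree_dart G tree_edges r d"
    unfolding tree_dart_def by blast
qed

text \<open>
  This turns the condition on tree paths in \<open>left_of_tree_path\<close> into one on parents and
  descendants.
\<close>

lemma path_through_iff:
  "(\<exists>ps qs. path tree_edges r (ps @ [a, b] @ qs) w) \<longleftrightarrow>
     P (target G a) = Some a \<and> P (target G b) = Some b \<and> target G a = origin G b \<and>
     desc (target G b) w"
proof
  assume "\<exists>ps qs. path tree_edges r (ps @ [a, b] @ qs) w"
  then obtain ps qs where p: "path tree_edges r (ps @ [a, b] @ qs) w" by blast
  note down = path_from_root_down[OF p]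
  have "walk tree_edges r (ps @ [a, b] @ qs) w"
    using p by (simp add: pre_digraph.apath_def)
  then have ab: "target G a = origin G b" and q: "walk tree_edges (target G b) qs w"
    by (auto simp: walk_append)
  have "w \<in> set (walk_verts tree_edges (target G b) qs)"
    using q
  proof (cases qs rule: rev_cases)
    case (snoc qs' d)
    then show ?thesis
      using walk_verts_snoc[of tree_edges "target G b" qs' d w] q by simp
  qed simp
  then have "desc (target G b) w"
    by (rule down_walk_desc[OF q, rotated]) (simp add: down)
  with ab show "P (target G a) = Some a \<and> P (target G b) = Some b \<and> target G a = origin G b \<and>
     desc (target G b) w"
    using down[of a] by (simp add: down)
next
  assume *: "P (target G a) = Some a \<and> P (target G b) = Some b \<and> target G a = origin G b \<and>
     desc (target G b) w"
  then have a: "P (target G a) = Some a" and b: "P (target G b) = Some b"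
    by auto
  obtain ps where p: "walk tree_edges r ps (origin G a)" "\<forall>d \<in> set ps. P (target G d) = Some d"
    using desc_down_walk[OF root_desc[OF parent_origin[OF a]] root_in] .
  obtain qs where q: "walk tree_edges (target G b) qs w" "\<forall>d \<in> set qs. P (target G d) = Some d"
    using desc_down_walk[of "target G b" w] * in_vertices[of "target G b"] by blast
  have "path tree_edges r (ps @ [a, b] @ qs) w"
    using p q * parent_dart[OF a] parent_dart[OF b]
    by (intro down_walk_path) (auto simp: walk_append ran_def)
  then show "\<exists>ps qs. path tree_edges r (ps @ [a, b] @ qs) w" by blast
qed

text \<open>
  A trail uses the edge above \<open>y\<close> at most once, whereas a closed walk in the tree leaves the subtree
  at \<open>y\<close> as often as it enters it, always by this edge.
\<close>

lemma no_closed_trail: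
  assumes w: "walk S u p u" and "p \<noteq> []" and dist: "distinct (map (edge_of G) p)"
  shows "\<not> edge_of G ` set p \<subseteq> tree_edges"
proof
  assume T: "edge_of G ` set p \<subseteq> tree_edges"
  obtain d q where p: "p = d # q"
    using assms by (cases p) auto
  have "edge_of G d \<in> tree_edges"
    using T p by auto
  then obtain y e where y: "P y = Some e" and e: "e = d \<or> e = flip G d"
    by (cases rule: tree_edge_cases) auto
  let ?f = "\<lambda>x. if desc y x then 1 else 0 :: int"
  have "?f (target G x) - ?f (origin G x) = 0" if "x \<in> set q" for x
  proof -
    have "edge_of G x \<noteq> edge_of G d"
      using dist that p by auto
    then have "x \<noteq> e" "x \<noteq> flip G e"
      using e by auto
    moreover have "edge_of G x \<in> tree_edges"
      using T that p by auto
    ultimately show ?thesis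
      using tree_edge_leaving_subtree[of x y] tree_edge_leaving_subtree[of "flip G x" y] y by auto
  qed
  then have "(\<Sum>x\<leftarrow>q. ?f (target G x) - ?f (origin G x)) = (\<Sum>x\<leftarrow>q. 0)"
    by (intro arg_cong[of _ _ sum_list] map_cong) auto
  moreover have "(\<Sum>x\<leftarrow>p. ?f (target G x) - ?f (origin G x)) = 0"
    using walk_increments[OF w, of ?f] by simp
  ultimately have "?f (target G d) = ?f (origin G d)"
    using p by simp
  then show False
    using e parent_target[OF y] parent_not_below[OF y] by (auto split: if_splits)
qed

end

section \<open>Spanning trees\<close>

definition map_connected :: "'d rooted_map \<Rightarrow> bool" where
  "map_connected G \<longleftrightarrow> (\<forall>A. A \<noteq> {} \<longrightarrow> A \<subseteq> vertex_set G \<longrightarrow>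
     (\<forall>d \<in> darts G. origin G d \<in> A \<longrightarrow> target G d \<in> A) \<longrightarrow> A = vertex_set G)"

locale spanning_tree = rooted_tree +
  assumes spanning: "insert r (dom P) = vertex_set G"
begin

lemma parent_exists:
  assumes "v \<in> vertex_set G" "v \<noteq> r"
  obtains d where "P v = Some d" "d \<in> darts G" "target G d = v"
  using assms spanning parent_dart parent_target by (metis domD insertE)

lemma card_spanning_tree: "card tree_edges + 1 = card (vertex_set G)"
proof -
  have "r \<notin> dom P" using root_None by auto
  moreover have "finite (dom P)"
    using spanning by (metis finite_insert finite_vertices)
  ultimately have "card (insert r (dom P)) = card (dom P) + 1"
    by simp
  then show ?thesis
    by (simp add: card_tree_edges spanning)
qed

end

text \<open>
  Parents are chosen one step closer to \<open>r\<close>.  As distinct vertices have distinct parent edges,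
  these edges exhaust \<open>S\<close> if it has fewer elements than there are vertices.
\<close>

lemma (in dart_graph) spanning_tree_exists:
  assumes r: "r \<in> vertex_set G" and S: "S \<subseteq> edge_set G" "card S < card (vertex_set G)"
    and conn: "\<And>A. r \<in> A \<Longrightarrow> A \<subseteq> vertex_set G \<Longrightarrow>
      (\<And>d. d \<in> darts G \<Longrightarrow> edge_of G d \<in> S \<Longrightarrow> origin G d \<in> A \<Longrightarrow> target G d \<in> A) \<Longrightarrow>
      A = vertex_set G"
  obtains Q where "spanning_tree G r Q" "edge_of G ` ran Q = S"
proof -
  let ?R = "{(origin G d, target G d) | d. d \<in> darts G \<and> edge_of G d \<in> S}"
  have reach: "(r, v) \<in> ?R\<^sup>*" if "v \<in> vertex_set G" for v
  proof -
    have "{v \<in> vertex_set G. (r, v) \<in> ?R\<^sup>*} = vertex_set G"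
    proof (rule conn)
      fix d assume "d \<in> darts G" "edge_of G d \<in> S" "origin G d \<in> {v \<in> vertex_set G. (r, v) \<in> ?R\<^sup>*}"
      moreover from this have "(origin G d, target G d) \<in> ?R" by blast
      ultimately show "target G d \<in> {v \<in> vertex_set G. (r, v) \<in> ?R\<^sup>*}"
        by (auto intro: rtrancl_into_rtrancl)
    qed (use r in auto)
    with that show ?thesis by blast
  qed
  \<comment> \<open>the distance from \<open>r\<close> in the graph with the edges \<open>S\<close>\<close>
  define \<delta> where "\<delta> v = (LEAST n. (r, v) \<in> ?R ^^ n)" for v
  have \<delta>: "(r, v) \<in> ?R ^^ \<delta> v" if "v \<in> vertex_set G" for v
  proof -
    have "\<exists>n. (r, v) \<in> ?R ^^ n"
      using reach[OF that] rtrancl_imp_relpow by blast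
    then show ?thesis unfolding \<delta>_def by (rule LeastI_ex)
  qed
  have ex: "\<exists>d. d \<in> darts G \<and> edge_of G d \<in> S \<and> target G d = v \<and> \<delta> (origin G d) < \<delta> v"
    if v: "v \<in> vertex_set G" "v \<noteq> r" for v
  proof (cases "\<delta> v")
    case 0
    with \<delta>[OF v(1)] v(2) show ?thesis by simp
  next
    case (Suc n)
    with \<delta>[OF v(1)] obtain w where w: "(r, w) \<in> ?R ^^ n" "(w, v) \<in> ?R"
      by auto
    then have "\<delta> w \<le> n" unfolding \<delta>_def by (intro Least_le)
    with w(2) Suc show ?thesis by fastforce
  qed
  define Q where "Q v = (if v \<in> vertex_set G \<and> v \<noteq> r
    then Some (SOME d. d \<in> darts G \<and> edge_of G d \<in> S \<and> target G d = v \<and> \<delta> (origin G d) < \<delta> v)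
    else None)" for v
  have Q: "d \<in> darts G \<and> edge_of G d \<in> S \<and> target G d = v \<and> \<delta> (origin G d) < \<delta> v"
    if "Q v = Some d" for v d
  proof -
    have v: "v \<in> vertex_set G" "v \<noteq> r"
      using that by (auto simp: Q_def split: if_splits)
    then have "d = (SOME d. d \<in> darts G \<and> edge_of G d \<in> S \<and> target G d = v \<and> \<delta> (origin G d) < \<delta> v)"
      using that by (simp add: Q_def)
    with someI_ex[OF ex[OF v]] show ?thesis by simp
  qed
  have dom: "insert r (dom Q) = vertex_set G"
    using r by (auto simp: Q_def split: if_splits)
  interpret Q: spanning_tree G r Q
  proof unfold_locales
    show "\<exists>\<delta>::'d set \<Rightarrow> nat. \<forall>v d. Q v = Some d \<longrightarrow> \<delta> (origin G d) < \<delta> v"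
      using Q by blast
    show "origin G d \<in> insert r (dom Q)" if "Q v = Some d" for v d
      using Q[OF that] dom by simp
  qed (use r Q dom in \<open>auto simp: Q_def\<close>)
  have "Q.tree_edges \<subseteq> S"
    using Q by (auto simp: ran_def)
  moreover have "finite S"
    using S(1) finite_edges finite_subset by blast
  ultimately have "Q.tree_edges = S"
    using Q.card_spanning_tree S(2) by (intro card_seteq) auto
  with Q.spanning_tree_axioms show ?thesis by (rule that)
qed


section \<open>Depth-first search\<close>

text \<open>
  The characterization of depth-first search trees as the spanning trees without edges between
  incomparable vertices.
\<close>

locale dfs_tree = spanning_tree +
  assumes comparable: "d \<in> darts G \<Longrightarrow> desc (origin G d) (target G d) \<or> desc (target G d) (origin G d)"

context rooted_tree
begin

context
  fixes z d
  assumes new: "z \<notin> insert r (dom P)" and d: "d \<in> darts G" "target G d = z"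
    and u: "origin G d \<in> insert r (dom P)"
begin

lemma rooted_tree_add_leaf: "rooted_tree G r (P(z \<mapsto> d))"
proof unfold_locales
  obtain \<delta> :: "'d set \<Rightarrow> nat" where \<delta>: "\<forall>v d. P v = Some d \<longrightarrow> \<delta> (origin G d) < \<delta> v"
    using depth_exists by blast
  have "(\<delta>(z := Suc (\<delta> (origin G d)))) (origin G e) < (\<delta>(z := Suc (\<delta> (origin G d)))) v"
    if "(P(z \<mapsto> d)) v = Some e" for v e
  proof (cases "v = z")
    case True
    with that u new show ?thesis by auto
  next
    case False
    with that have v: "P v = Some e" by simp
    then have "origin G e \<noteq> z"
      using parent_origin new by blast
    with False v \<delta> show ?thesis by simp
  qed
  then show "\<exists>\<delta>::'d set \<Rightarrow> nat. \<forall>v e. (P(z \<mapsto> d)) v = Some e \<longrightarrow> \<delta> (origin G e) < \<delta> v"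
    by blast
  show "origin G e \<in> insert r (dom (P(z \<mapsto> d)))" if "(P(z \<mapsto> d)) v = Some e" for v e
    using that u parent_origin[of v e] by (auto split: if_splits)
qed (use root_in new d u root_None parent_dart parent_target in \<open>auto split: if_splits\<close>)

text \<open>
  A search only ever adds leaves, so what is known about visited vertices remains true.
\<close>

lemma desc_add_leaf:
  "descends G (P(z \<mapsto> d)) a b \<longleftrightarrow> (if b = z then a = z \<or> desc a (origin G d) else desc a b)"
proof -
  have old: "descends G (P(z \<mapsto> d)) a b \<longleftrightarrow> desc a b" if "b \<noteq> z" for b
    using that
  proof (induction "depth b" arbitrary: b rule: less_induct)
    case less
    show ?case
    proof (cases "P b")
      case None
      with less.prems show ?thesis
        by (simp add: descends_None_iff)
    next
      case (Some e)
      then have "origin G e \<noteq> z"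
        using parent_origin new by blast
      then have "descends G (P(z \<mapsto> d)) a (origin G e) \<longleftrightarrow> desc a (origin G e)"
        using less.hyps depth_parent[OF Some] by blast
      moreover have "(P(z \<mapsto> d)) b = Some e"
        using Some less.prems by simp
      ultimately show ?thesis
        using descends_step_iff[of P b e G a, OF Some]
          descends_step_iff[of "P(z \<mapsto> d)" b e G a] by blast
    qed
  qed
  have "origin G d \<noteq> z"
    using u new by blast
  then show ?thesis
    using old[of b] old[of "origin G d"] descends_step_iff[of "P(z \<mapsto> d)" z d G a] by auto
qed

end

end

lemma (in dart_graph) forward_dartsD:
  assumes "d \<in> forward_darts G X u"
  shows "d \<in> darts G" "origin G d = u" "target G d \<notin> X"
  using assms by (auto simp: forward_darts_def)

text \<open>
  The invariant of the search: only the ancestors of the chip may still have unvisited neighbours,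
  so that a newly visited vertex is below all its visited neighbours.
\<close>

lemma (in dart_graph) dfs_invariant:
  assumes "dfs_reaches G r allowed u X P" and r: "r \<in> vertex_set G"
  shows "rooted_tree G r P \<and> X = insert r (dom P) \<and> u \<in> X \<and>
    (\<forall>v \<in> X. \<not> descends G P v u \<longrightarrow> forward_darts G X v = {}) \<and>
    (\<forall>d \<in> darts G. origin G d \<in> X \<and> target G d \<in> X \<longrightarrow>
      descends G P (origin G d) (target G d) \<or> descends G P (target G d) (origin G d))"
  using assms(1)
proof induction
  case start
  have "rooted_tree G r Map.empty"
    by unfold_locales (use r in auto)
  then show ?case by simp
next
  case (forward u X P d)
  note IH = forward.IH
  define z where "z = target G d"
  interpret rooted_tree G r P using IH by blast
  have X: "X = insert r (dom P)" and uX: "u \<in> X" using IH by auto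
  have d: "d \<in> darts G" "origin G d = u" "z \<notin> X"
    using forward_dartsD[OF forward.hyps(2)] by (auto simp: z_def)
  have leaf: "z \<notin> insert r (dom P)" "d \<in> darts G" "target G d = z" "origin G d \<in> insert r (dom P)"
    using d uX X z_def by auto
  note desc' = desc_add_leaf[OF leaf]
  have stack: "desc v u" if "e \<in> darts G" "origin G e = v" "target G e = z" "v \<in> X" for v e
  proof (rule ccontr)
    assume "\<not> desc v u"
    then have "forward_darts G X v = {}" using IH that by blast
    with that d(3) show False by (auto simp: forward_darts_def)
  qed
  have "forward_darts G (insert z X) v = {}"
    if "v \<in> insert z X" "\<not> descends G (P(z \<mapsto> d)) v z" for v
  proof -
    have "v \<noteq> z" "\<not> desc v u"
      using that d by (auto simp: desc')
    then have "forward_darts G X v = {}" using IH that by blast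
    then show ?thesis by (auto simp: forward_darts_def)
  qed
  moreover have "descends G (P(z \<mapsto> d)) (origin G e) (target G e) \<or>
      descends G (P(z \<mapsto> d)) (target G e) (origin G e)"
    if e: "e \<in> darts G" "origin G e \<in> insert z X" "target G e \<in> insert z X" for e
  proof -
    have 1: ?thesis if "target G e = z" "origin G e \<in> X"
      using stack[of e "origin G e"] e that d by (auto simp: desc')
    have 2: ?thesis if "origin G e = z" "target G e \<in> X"
      using stack[of "flip G e" "target G e"] e that d by (auto simp: desc')
    have 3: ?thesis if "origin G e \<in> X" "target G e \<in> X"
    proof -
      have "desc (origin G e) (target G e) \<or> desc (target G e) (origin G e)"
        using IH e that by blast
      moreover have "origin G e \<noteq> z" "target G e \<noteq> z"
        using that d(3) by blast+
      ultimately show ?thesis by (simp add: desc')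
    qed
    have 4: ?thesis if "origin G e = z" "target G e = z"
      using that by simp
    from 1 2 3 4 e(2,3) show ?thesis by blast
  qed
  moreover have "insert z X = insert r (dom (P(z \<mapsto> d)))"
    using X by auto
  ultimately show ?case
    using rooted_tree_add_leaf[OF leaf] unfolding z_def[symmetric] by blast
next
  case (backward u X P d)
  note IH = backward.IH
  interpret rooted_tree G r P using IH by blast
  have "forward_darts G X v = {}" if "v \<in> X" "\<not> desc v (origin G d)" for v
  proof (cases "v = u")
    case False
    then have "\<not> desc v u"
      using that descends_step_iff[of P u d G v, OF backward.hyps(4)] by blast
    then show ?thesis using IH that by blast
  qed (use backward.hyps in simp)
  moreover have "origin G d \<in> X"
    using IH parent_origin[OF backward.hyps(4)] by simp
  ultimately show ?case using IH by blast
qed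

lemma (in dart_graph) dfs_final_dfs_tree:
  assumes "dfs_reaches G r allowed r X P" "forward_darts G X r = {}"
    and r: "r \<in> vertex_set G" and conn: "map_connected G"
  shows "dfs_tree G r P"
proof -
  note inv = dfs_invariant[OF assms(1) r]
  interpret rooted_tree G r P using inv by blast
  have X: "X = insert r (dom P)" using inv by blast
  have stuck: "forward_darts G X v = {}" if "v \<in> X" for v
    using inv that assms(2) by (cases "v = r") (auto simp: desc_root_iff)
  have "X = vertex_set G"
  proof -
    have "X \<subseteq> vertex_set G" using X in_vertices by blast
    moreover have "target G d \<in> X" if "d \<in> darts G" "origin G d \<in> X" for d
      using stuck[of "origin G d"] that by (auto simp: forward_darts_def)
    moreover have "X \<noteq> {}" using X by simp
    ultimately show ?thesis
      using conn[unfolded map_connected_def, rule_format, of X] by blast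
  qed
  then show ?thesis
    using inv X by unfold_locales auto
qed

lemma dfs_reaches_mono:
  assumes "dfs_reaches G r allowed u X P"
    and "\<And>u X P d. allowed u X P d \<Longrightarrow> allowed' u X P d"
  shows "dfs_reaches G r allowed' u X P"
  using assms(1)
proof induction
  case (forward u X P d)
  then show ?case by (intro dfs_reaches.forward assms(2))
qed (blast intro: dfs_reaches.intros)+

text \<open>
  Every step backward goes to a vertex of smaller depth, and every step forward visits a new
  vertex.
\<close>

lemma (in dart_graph) dfs_terminates:
  assumes r: "r \<in> vertex_set G"
    and progress: "\<And>u X P. dfs_reaches G r allowed u X P \<Longrightarrow> forward_darts G X u \<noteq> {} \<Longrightarrow>
      \<exists>d \<in> forward_darts G X u. allowed u X P d"
  shows "\<exists>X P. dfs_reaches G r allowed r X P \<and> forward_darts G X r = {}"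
proof -
  have "\<exists>X P. dfs_reaches G r allowed r X P \<and> forward_darts G X r = {}"
    if "dfs_reaches G r allowed u X P" for u X P
    using that
  proof (induction "card (vertex_set G - X)" arbitrary: u X P rule: less_induct)
    case less
    note outer = less.hyps
    from less.prems show ?case
    proof (induction "rooted_tree.depth G P u" arbitrary: u rule: less_induct)
      case less
      note inv = dfs_invariant[OF less.prems r]
      interpret rooted_tree G r P using inv by blast
      show ?case
      proof (cases "forward_darts G X u = {}")
        case False
        then obtain d where d: "d \<in> forward_darts G X u" "allowed u X P d"
          using progress less.prems by blast
        have "target G d \<in> vertex_set G - X"
          using forward_dartsD[OF d(1)] by simp
        then have "card (vertex_set G - insert (target G d) X) < card (vertex_set G - X)"
          by (intro psubset_card_mono) auto
        then show ?thesis
          by (rule outer) (rule dfs_reaches.forward[OF less.prems d])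
      next
        case True
        show ?thesis
        proof (cases "u = r")
          case False
          with inv obtain d where d: "P u = Some d" by auto
          show ?thesis
            using less.hyps[OF depth_parent[OF d]] dfs_reaches.backward[OF less.prems True False d]
            by blast
        qed (use True less.prems in blast)
      qed
    qed
  qed
  then show ?thesis using dfs_reaches.start by blast
qed

context dfs_tree
begin

text \<open>
  A search that has kept to the tree so far can only discover descendants of the chip, and the
  way to them in the tree is still unvisited: a visited child of the chip has been left, with
  everything below it visited.
\<close>

lemma forward_dart_tree_child:
  assumes reach: "dfs_reaches G r allowed u X P'" and sub: "P' \<subseteq>\<^sub>m P"
    and d: "d \<in> forward_darts G X u"
  obtains e where "e \<in> forward_darts G X u" "P (target G e) = Some e"
    "desc (target G e) (target G d)"
proof -
  note inv = dfs_invariant[OF reach root_in]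
  interpret P': rooted_tree G r P' using inv by blast
  have X: "X = insert r (dom P')" and u: "u \<in> X" using inv by auto
  have agree: "P v = Some d" if "P' v = Some d" for v d
    using sub that by (auto simp: map_le_def dom_def)
  have desc': "desc a b" if "P'.desc a b" for a b
  proof -
    have "parent_rel G P' \<subseteq> parent_rel G P"
      using agree by (auto simp: parent_rel_def)
    with that show ?thesis
      unfolding descends_def using rtrancl_mono by blast
  qed
  have up: "a \<in> X" if "desc a b" "b \<in> X" for a b
    using that unfolding descends_def
  proof (induction rule: converse_rtrancl_induct)
    case (step a a')
    then obtain e where e: "P a' = Some e" "origin G e = a" by (auto simp: parent_rel_def)
    from step have "a' \<in> X" by blast
    then obtain e' where e': "P' a' = Some e'"
      using X e root_None by auto
    with agree e have "e' = e" by fastforce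
    with P'.parent_origin[OF e'] X e show ?case by simp
  qed
  note dD = forward_dartsD[OF d]
  have "\<not> desc (target G d) u"
    using up u dD by blast
  with comparable[OF dD(1)] dD have "desc u (target G d)" by simp
  moreover have "u \<noteq> target G d" using u dD by blast
  ultimately obtain e where e: "P (target G e) = Some e" "origin G e = u"
    "desc (target G e) (target G d)"
    by (rule desc_child)
  \<comment> \<open>otherwise this child has been left for good and everything below it is visited\<close>
  have "target G e \<notin> X"
  proof
    assume y: "target G e \<in> X"
    have "x \<in> X" if "desc (target G e) x" for x
      using that unfolding descends_def
    proof (induction rule: rtrancl_induct)
      case (step x x')
      then obtain e' where e': "P x' = Some e'" "origin G e' = x" by (auto simp: parent_rel_def)
      have "\<not> P'.desc x u"
        using step(1) desc'[of x u] e parent_not_below[OF e(1)]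
        by (metis descends_def descends_trans)
      then have "forward_darts G X x = {}"
        using inv step.IH by blast
      with e' parent_dart[OF e'(1)] parent_target[OF e'(1)] show ?case
        by (auto simp: forward_darts_def)
    qed (use y in simp)
    with e dD show False by blast
  qed
  with e parent_dart[OF e(1)] show ?thesis
    by (intro that) (auto simp: forward_darts_def)
qed

lemma dfs_follows_tree:
  assumes "dfs_reaches G r allowed u X P'"
    and "\<And>u X P' d. dfs_reaches G r allowed u X P' \<Longrightarrow> P' \<subseteq>\<^sub>m P \<Longrightarrow> d \<in> forward_darts G X u \<Longrightarrow>
      allowed u X P' d \<Longrightarrow> P (target G d) = Some d"
  shows "P' \<subseteq>\<^sub>m P"
  using assms(1)
proof induction
  case (forward u X P' d)
  then have "P (target G d) = Some d"
    using assms(2) by blast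
  with forward.IH show ?case
    by (simp add: map_le_def dom_def)
qed (auto simp: map_le_def)

end

section \<open>Planar maps and their duals\<close>

lemma orbit_eq_iff:
  assumes "permutation f"
  shows "orbit f x = orbit f y \<longleftrightarrow> x \<in> orbit f y"
proof
  assume "orbit f x = orbit f y"
  then show "x \<in> orbit f y"
    using permutation_self_in_orbit[OF assms, of x] by simp
next
  assume "x \<in> orbit f y"
  then show "orbit f x = orbit f y"
    by (rule orbit_cyclic_eq3[OF cyclic_on_orbit'[OF assms]])
qed

lemma orbit_card_3:
  assumes "permutation f" "card (orbit f x) = 3"
  shows "orbit f x = {x, f x, f (f x)}" "f (f (f x)) = x"
    "f x \<noteq> x" "f (f x) \<noteq> x" "f (f x) \<noteq> f x"
proof -
  let ?n = "funpow_dist1 f x x"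
  note self = permutation_self_in_orbit[OF assms(1), of x]
  have orb: "orbit f x = (\<lambda>n. (f ^^ n) x) ` {0..<?n}"
    by (rule orbit_conv_funpow_dist1[OF self])
  have inj: "inj_on (\<lambda>n. (f ^^ n) x) {0..<?n}"
    by (rule inj_on_funpow_dist1[OF self])
  have n: "?n = 3"
    using assms(2) card_image[OF inj] orb by simp
  show "f (f (f x)) = x"
    using funpow_dist1_prop[OF self] unfolding n by (simp add: numeral_3_eq_3)
  have set: "{0..<3} = {0, Suc 0, Suc (Suc 0)}"
    by auto
  show orb3: "orbit f x = {x, f x, f (f x)}"
    using orb unfolding n set by simp
  show "f x \<noteq> x" "f (f x) \<noteq> x" "f (f x) \<noteq> f x"
    using inj unfolding n set by (auto simp: inj_on_def)
qed

text \<open>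
  The vertex of the dual at the origin of a dart \<open>d\<close> is \<open>right_face M d\<close>, the one at its target is
  \<open>right_face M (flip M d)\<close>.  Stating facts on the dual in this form lets primal and dual
  arguments share the same darts.
\<close>

locale planar_map =
  fixes M :: "'d rooted_map"
  assumes planar: "rooted_planar_map M"
begin

abbreviation root_face_vertex :: "'d set" (\<open>v\<^sub>0\<close>) where
  "v\<^sub>0 \<equiv> right_face M (root_dart M)"

lemma rot_permutes: "rot M permutes darts M"
  and flip_permutes: "flip M permutes darts M"
  and finite_map_darts: "finite (darts M)"
  and root_dart_in [simp]: "root_dart M \<in> darts M"
  and flip_neq [simp]: "d \<in> darts M \<Longrightarrow> flip M d \<noteq> d"
  using planar by (auto simp: rooted_planar_map_def)

lemma map_flip_flip [simp]: "flip M (flip M d) = d"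
  using planar flip_permutes by (cases "d \<in> darts M") (auto simp: rooted_planar_map_def permutes_not_in)

lemma permutation_rot: "permutation (rot M)"
  using rot_permutes finite_map_darts by (auto simp: permutation_permutes)

lemma face_perm_permutes: "face_perm M permutes darts M"
  unfolding face_perm_def by (rule permutes_compose[OF flip_permutes rot_permutes])

lemma permutation_face_perm: "permutation (face_perm M)"
  using face_perm_permutes finite_map_darts by (auto simp: permutation_permutes)

lemma dual_simps [simp]:
  "darts (dual M) = darts M" "flip (dual M) = flip M" "root_dart (dual M) = root_dart M"
  "inv (rot (dual M)) = face_perm M"
  using permutes_bij[OF face_perm_permutes] by (simp_all add: dual_def inv_inv_eq)

lemma edge_of_dual [simp]: "edge_of (dual M) = edge_of M"
  by (simp add: edge_of_def fun_eq_iff)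

lemma edge_set_dual [simp]: "edge_set (dual M) = edge_set M"
  by (simp add: edge_set_def)

lemma origin_dual_eq [simp]: "origin (dual M) = right_face M"
  using origin_dual[OF planar] by (rule ext)

lemma target_dual_eq [simp]: "target (dual M) d = right_face M (flip M d)"
  by (simp add: target_def)

lemma vertex_set_dual [simp]: "vertex_set (dual M) = face_set M"
  by (simp add: vertex_set_def face_set_def)

sublocale primal: dart_graph M
  using finite_map_darts permutes_in_image[OF flip_permutes] by unfold_locales auto

sublocale dual: dart_graph "dual M"
  using finite_map_darts permutes_in_image[OF flip_permutes] by unfold_locales auto

lemma rot_in [simp]: "rot M d \<in> darts M \<longleftrightarrow> d \<in> darts M"
  using permutes_in_image[OF rot_permutes] .

lemma face_perm_in [simp]: "face_perm M d \<in> darts M \<longleftrightarrow> d \<in> darts M"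
  using permutes_in_image[OF face_perm_permutes] .

lemma face_perm_flip [simp]: "face_perm M (flip M d) = rot M d"
  by (simp add: face_perm_def)

lemma origin_eq_iff: "origin M d = origin M e \<longleftrightarrow> d \<in> origin M e"
  unfolding origin_def by (rule orbit_eq_iff[OF permutation_rot])

lemma right_face_eq_iff: "right_face M d = right_face M e \<longleftrightarrow> d \<in> right_face M e"
  unfolding right_face_def by (rule orbit_eq_iff[OF permutation_face_perm])

lemma origin_rot [simp]: "origin M (rot M d) = origin M d"
  unfolding origin_eq_iff by (simp add: origin_def orbit.base)

lemma right_face_face_perm [simp]: "right_face M (face_perm M d) = right_face M d"
  unfolding right_face_eq_iff by (simp add: right_face_def orbit.base)

lemma right_face_rot [simp]: "right_face M (rot M d) = right_face M (flip M d)"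
  using right_face_face_perm[of "flip M d"] by simp

lemma origin_face_perm [simp]: "origin M (face_perm M d) = target M d"
  by (simp add: face_perm_def)

lemma right_face_in_faces [simp]: "d \<in> darts M \<Longrightarrow> right_face M d \<in> face_set M"
  by (simp add: face_set_def)

lemma darts_at_vertex:
  assumes "d \<in> darts M"
  shows "{e \<in> darts M. origin M e = origin M d} = orbit (rot M) d"
proof -
  have "orbit (rot M) d \<subseteq> darts M"
    by (rule permutes_orbit_subset[OF rot_permutes assms])
  then show ?thesis
    by (auto simp: origin_eq_iff) (simp_all add: origin_def)
qed

lemma darts_at_face:
  assumes "d \<in> darts M"
  shows "{e \<in> darts M. right_face M e = right_face M d} = orbit (face_perm M) d"
proof -
  have "orbit (face_perm M) d \<subseteq> darts M"
    by (rule permutes_orbit_subset[OF face_perm_permutes assms])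
  then show ?thesis
    by (auto simp: right_face_eq_iff) (simp_all add: right_face_def)
qed

lemma root_face_iff: "d \<in> v\<^sub>0 \<longleftrightarrow> d \<in> darts M \<and> right_face M d = v\<^sub>0"
  using darts_at_face[of "root_dart M"] by (auto simp: right_face_eq_iff right_face_def)

text \<open>
  Sets of vertices of a map induce circulations on its dual, and conversely: around a face, the
  target of a dart is the origin of the next one.
\<close>

definition vertex_flow :: "'d set set \<Rightarrow> 'd \<Rightarrow> int" where
  "vertex_flow A d = of_bool (origin M d \<in> A) - of_bool (target M d \<in> A)"

definition face_flow :: "'d set set \<Rightarrow> 'd \<Rightarrow> int" where
  "face_flow S d = of_bool (right_face M d \<in> S) - of_bool (right_face M (flip M d) \<in> S)"

lemma circulation_vertex_flow: "dual.circulation (vertex_flow A)"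
  unfolding dual.circulation_def
proof (intro conjI ballI)
  fix f assume "f \<in> vertex_set (dual M)"
  then obtain d where d: "d \<in> darts M" "f = right_face M d"
    by (auto simp: face_set_def)
  have "(\<Sum>e | e \<in> darts (dual M) \<and> origin (dual M) e = f. vertex_flow A e) =
      (\<Sum>e\<in>orbit (face_perm M) d. vertex_flow A e)"
    using d darts_at_face by simp
  also have "\<dots> = 0"
    using sum_orbit_shift[OF permutation_face_perm, of "\<lambda>e. of_bool (origin M e \<in> A)" d]
    by (simp add: vertex_flow_def sum_subtractf)
  finally show "(\<Sum>e | e \<in> darts (dual M) \<and> origin (dual M) e = f. vertex_flow A e) = 0" .
qed (simp add: vertex_flow_def)

lemma circulation_face_flow: "primal.circulation (face_flow S)"
  unfolding primal.circulation_def
proof (intro conjI ballI)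
  fix v assume "v \<in> vertex_set M"
  then obtain d where d: "d \<in> darts M" "v = origin M d"
    by (auto simp: vertex_set_def)
  have "(\<Sum>e | e \<in> darts M \<and> origin M e = v. face_flow S e) =
      (\<Sum>e\<in>orbit (rot M) d. face_flow S e)"
    using d darts_at_vertex by simp
  also have "\<dots> = 0"
    using sum_orbit_shift[OF permutation_rot, of "\<lambda>e. of_bool (right_face M e \<in> S)" d]
    by (simp add: face_flow_def sum_subtractf)
  finally show "(\<Sum>e | e \<in> darts M \<and> origin M e = v. face_flow S e) = 0" .
qed (simp add: face_flow_def)

lemma vertex_flow_eq_0_iff: "vertex_flow A d = 0 \<longleftrightarrow> (origin M d \<in> A \<longleftrightarrow> target M d \<in> A)"
  by (simp add: vertex_flow_def)

lemma connected_primal: "map_connected M"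
  unfolding map_connected_def
proof (intro allI impI)
  fix A assume A: "A \<noteq> {}" "A \<subseteq> vertex_set M"
    "\<forall>d \<in> darts M. origin M d \<in> A \<longrightarrow> target M d \<in> A"
  interpret G: wf_digraph "edge_graph M (edge_set M)"
    by unfold_locales (auto simp: edge_graph_def)
  obtain a where a: "a \<in> A" using A(1) by blast
  have "v \<in> A" if "v \<in> vertex_set M" for v
  proof -
    have "a \<rightarrow>\<^sup>*\<^bsub>edge_graph M (edge_set M)\<^esub> v"
      using planar that a A(2) by (auto simp: rooted_planar_map_def strongly_connected_def edge_graph_def)
    then obtain p where "primal.walk (edge_set M) a p v"
      using G.reachable_awalk by blast
    then show "v \<in> A"
      using a A(3) by (induction p arbitrary: a) auto
  qed
  with A(2) show "A = vertex_set M" by blast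
qed

text \<open>
  If a set of faces is closed under adjacency, the darts with right face in it form a set closed
  under \<open>flip\<close> and \<open>rot\<close>, and these connect all darts.
\<close>

lemma connected_dual: "map_connected (dual M)"
  unfolding map_connected_def
proof (intro allI impI)
  fix S assume S: "S \<noteq> {}" "S \<subseteq> vertex_set (dual M)"
    "\<forall>d \<in> darts (dual M). origin (dual M) d \<in> S \<longrightarrow> target (dual M) d \<in> S"
  let ?Y = "{d \<in> darts M. right_face M d \<in> S}"
  have rot: "orbit (rot M) d \<subseteq> ?Y" if "d \<in> ?Y" for d
  proof
    fix x assume "x \<in> orbit (rot M) d"
    then show "x \<in> ?Y"
      using that S(3) by induction auto
  qed
  obtain f where "f \<in> S" using S(1) by blast
  with S(2) have "?Y \<noteq> {}" by (auto simp: face_set_def)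
  moreover have "target M d \<in> origin M ` ?Y" if d: "d \<in> darts M" "origin M d \<in> origin M ` ?Y" for d
  proof -
    from d(2) obtain e where e: "e \<in> ?Y" "origin M d = origin M e" by blast
    then have "d \<in> orbit (rot M) e"
      using darts_at_vertex[of e] d by blast
    then have "d \<in> ?Y" using rot[OF e(1)] by blast
    then have "flip M d \<in> ?Y" using S(3) by auto
    then show ?thesis
      using primal.origin_flip[of d] by (metis (no_types, lifting) imageI)
  qed
  ultimately have all: "origin M ` ?Y = vertex_set M"
    using connected_primal[unfolded map_connected_def, rule_format, of "origin M ` ?Y"]
    by (auto simp: vertex_set_def)
  have "right_face M d \<in> S" if d: "d \<in> darts M" for d
  proof -
    have "origin M d \<in> origin M ` ?Y" using all d by simp
    then obtain e where e: "e \<in> ?Y" "origin M d = origin M e" by blast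
    then have "d \<in> orbit (rot M) e"
      using darts_at_vertex[of e] d by blast
    then show ?thesis using rot[OF e(1)] by blast
  qed
  then show "S = vertex_set (dual M)"
    using S(2) by (auto simp: face_set_def)
qed

end

locale boundary_triangulation = planar_map M for M :: "'d rooted_map" +
  assumes no_loops: "loopless M"
    and triangular: "near_triangulation M"
    and simple_boundary: "simple_root_boundary M"
begin

lemma root_face_target_inj:
  assumes "d \<in> v\<^sub>0" "e \<in> v\<^sub>0" "origin M d = origin M e"
  shows "d = e"
  using simple_boundary assms by (auto simp: simple_root_boundary_def inj_on_def)

lemma triangle:
  assumes "d \<in> darts M" "right_face M d \<noteq> v\<^sub>0"
  shows "face_perm M (face_perm M (face_perm M d)) = d"
    and "e \<in> darts M \<Longrightarrow> right_face M e = right_face M d \<Longrightarrow>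
      e = d \<or> e = face_perm M d \<or> e = face_perm M (face_perm M d)"
    and "face_perm M d \<noteq> d" "face_perm M (face_perm M d) \<noteq> d"
    and "face_perm M (face_perm M d) \<noteq> face_perm M d"
proof -
  have "card (right_face M d) = 3"
    using triangular assms by (auto simp: near_triangulation_def face_set_def)
  note 3 = orbit_card_3[OF permutation_face_perm this[unfolded right_face_def]]
  show "face_perm M (face_perm M (face_perm M d)) = d" "face_perm M d \<noteq> d"
    "face_perm M (face_perm M d) \<noteq> d" "face_perm M (face_perm M d) \<noteq> face_perm M d"
    using 3 by auto
  show "e = d \<or> e = face_perm M d \<or> e = face_perm M (face_perm M d)"
    if "e \<in> darts M" "right_face M e = right_face M d"
  proof -
    have "e \<in> orbit (face_perm M) d"
      using that(2) unfolding right_face_eq_iff by (simp add: right_face_def)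
    then show ?thesis unfolding 3(1) by blast
  qed
qed

lemma origin_neq_target: "d \<in> darts M \<Longrightarrow> origin M d \<noteq> target M d"
  using no_loops by (simp add: loopless_def)

text \<open>A triangle glued to itself along an edge would have a loop as its third side.\<close>

lemma dual_loopless:
  assumes d: "d \<in> darts M"
  shows "right_face M d \<noteq> right_face M (flip M d)"
proof
  assume eq: "right_face M d = right_face M (flip M d)"
  show False
  proof (cases "right_face M d = v\<^sub>0")
    case True
    then have "d \<in> v\<^sub>0" "flip M d \<in> v\<^sub>0"
      using d eq by (auto simp: root_face_iff)
    moreover have "edge_of M d = edge_of M (flip M d)" by simp
    ultimately have "d = flip M d"
      using simple_boundary by (auto simp: simple_root_boundary_def inj_on_def)
    with d show False by (metis flip_neq)
  next
    case False
    let ?a = "face_perm M d" and ?b = "face_perm M (face_perm M d)"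
    have "flip M d = ?a \<or> flip M d = ?b"
      using triangle(2)[OF d False, of "flip M d"] d eq by auto
    then show False
    proof
      assume "flip M d = ?a"
      then have "origin M ?b = origin M d"
        using origin_face_perm[of ?a] by (metis primal.target_flip)
      also have "\<dots> = target M ?b"
        using origin_face_perm[of ?b] triangle(1)[OF d False] by simp
      finally show False using origin_neq_target[of ?b] d by simp
    next
      assume "flip M d = ?b"
      then have "target M ?a = origin M ?a"
        using origin_face_perm[of ?a] origin_face_perm[of d] by (metis primal.origin_flip)
      then show False using origin_neq_target[of ?a] d by simp
    qed
  qed
qed

text \<open>
  By simplicity of the boundary only two outer edges meet at an outer vertex, so a flow carried
  by the outer edges is constant along the boundary.
\<close>

lemma face_flow_outer_constant:
  assumes supp: "\<And>d. d \<in> darts M \<Longrightarrow> face_flow S d \<noteq> 0 \<Longrightarrow> d \<in> v\<^sub>0 \<or> flip M d \<in> v\<^sub>0"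
    and d: "d \<in> v\<^sub>0"
  shows "face_flow S d = face_flow S (root_dart M)"
proof -
  have step: "face_flow S (face_perm M e) = face_flow S e" if e: "e \<in> v\<^sub>0" for e
  proof -
    have eD: "e \<in> darts M" and fe: "face_perm M e \<in> v\<^sub>0"
      using e by (auto simp: root_face_iff)
    let ?w = "target M e"
    let ?W = "{x \<in> darts M. origin M x = ?w}"
    \<comment> \<open>the other darts at \<open>?w\<close> belong to inner edges\<close>
    have "face_flow S x = 0" if x: "x \<in> ?W" "x \<noteq> face_perm M e" "x \<noteq> flip M e" for x
    proof (rule ccontr)
      assume "face_flow S x \<noteq> 0"
      then consider "x \<in> v\<^sub>0" | "flip M x \<in> v\<^sub>0"
        using supp x by blast
      then show False
      proof cases
        case 1
        then show False
          using root_face_target_inj[OF 1 fe] x by simp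
      next
        case 2
        then have "face_perm M (flip M x) \<in> v\<^sub>0" by (auto simp: root_face_iff)
        moreover have "origin M (face_perm M (flip M x)) = ?w"
          using x by simp
        ultimately have "face_perm M (flip M x) = face_perm M e"
          using root_face_target_inj[of "face_perm M (flip M x)" "face_perm M e"] fe by simp
        then have "flip M x = e"
          by (rule injD[OF permutes_inj[OF face_perm_permutes]])
        with x show False by auto
      qed
    qed
    then have "sum (face_flow S) ?W = sum (face_flow S) {face_perm M e, flip M e}"
      using eD by (intro sum.mono_neutral_right) auto
    moreover have "sum (face_flow S) ?W = 0"
      using circulation_face_flow[of S] eD unfolding primal.circulation_def by simp
    moreover have "face_perm M e \<noteq> flip M e"
      using fe e dual_loopless[OF eD] by (metis root_face_iff)
    ultimately have "face_flow S (face_perm M e) + face_flow S (flip M e) = 0"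
      by simp
    then show ?thesis
      using primal.circulation_flip[OF circulation_face_flow eD, of S] by simp
  qed
  have "d \<in> orbit (face_perm M) (root_dart M)"
    using d by (simp add: right_face_def)
  then have "d \<in> v\<^sub>0 \<and> face_flow S d = face_flow S (root_dart M)"
  proof induction
    case base
    show ?case using step[of "root_dart M"] by (auto simp: root_face_iff)
  next
    case (step x)
    then show ?case
      using \<open>\<And>e. e \<in> v\<^sub>0 \<Longrightarrow> face_flow S (face_perm M e) = face_flow S e\<close>[of x]
      by (auto simp: root_face_iff)
  qed
  then show ?thesis by blast
qed

end

section \<open>Depth-first search trees of the dual and their complements\<close>

locale dual_search_tree = boundary_triangulation M +
    T: dfs_tree "dual M" "right_face M (root_dart M)" P for M :: "'d rooted_map" and P +
  assumes root_child: "P (right_face M (flip M (root_dart M))) = Some (root_dart M)"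
begin

lemma parent_dart: "P v = Some d \<Longrightarrow> d \<in> darts M"
  using T.parent_dart[of v d] by simp

lemma parent_target: "P v = Some d \<Longrightarrow> right_face M (flip M d) = v"
  using T.parent_target[of v d] by simp

lemma desc_step_iff: "P v = Some d \<Longrightarrow> T.desc u v \<longleftrightarrow> u = v \<or> T.desc u (right_face M d)"
  using descends_step_iff[of P v d "dual M" u] by simp

lemma parent_not_below: "P v = Some d \<Longrightarrow> \<not> T.desc v (right_face M d)"
  using T.parent_not_below[of v d] by simp

lemma tree_edge_cases:
  assumes "edge_of M d \<in> T.tree_edges"
  obtains "P (right_face M (flip M d)) = Some d" | "P (right_face M d) = Some (flip M d)"
  using T.tree_edge_cases[of d] assms by auto

lemma tree_edgeI: "P v = Some d \<Longrightarrow> edge_of M d \<in> T.tree_edges"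
  by (auto simp: ran_def)

lemma comparable:
  "d \<in> darts M \<Longrightarrow> T.desc (right_face M d) (right_face M (flip M d)) \<or>
     T.desc (right_face M (flip M d)) (right_face M d)"
  using T.comparable[of d] by simp

text \<open>
  Let \<open>y\<close> be another child of \<open>v\<^sub>0\<close>.  All edges leaving the subtree at \<open>y\<close> end at \<open>v\<^sub>0\<close>, so the
  flow of the subtree is carried by the outer edges; it is constant there, but vanishes at the
  root-edge and not below \<open>y\<close>.
\<close>

lemma root_has_one_child:
  assumes y: "P y = Some d" "right_face M d = v\<^sub>0"
  shows "d = root_dart M"
proof (rule ccontr)
  assume neq: "d \<noteq> root_dart M"
  let ?S = "{x. T.desc y x}"
  let ?t = "right_face M (flip M (root_dart M))"
  have "y \<noteq> ?t"
    using neq y(1) root_child by auto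
  moreover have r: "\<not> T.desc y v\<^sub>0"
    using T.desc_root_iff T.root_None y(1) by auto
  ultimately have t: "\<not> T.desc y ?t"
    using desc_step_iff[OF root_child] by blast
  have out: "right_face M (flip M e) = v\<^sub>0"
    if e: "e \<in> darts M" "T.desc y (right_face M e)" "\<not> T.desc y (right_face M (flip M e))" for e
  proof -
    have "T.desc (right_face M (flip M e)) (right_face M e)"
      using comparable[OF e(1)] e(2,3) descends_trans by blast
    then have "T.desc (right_face M (flip M e)) y"
      using T.desc_comparable e(2,3) by blast
    then have "T.desc (right_face M (flip M e)) v\<^sub>0"
      using desc_step_iff[OF y(1)] e(3) y(2) by auto
    then show ?thesis using T.desc_root_iff by simp
  qed
  have "e \<in> v\<^sub>0 \<or> flip M e \<in> v\<^sub>0" if "e \<in> darts M" "face_flow ?S e \<noteq> 0" for e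
  proof -
    have "T.desc y (right_face M e) \<noteq> T.desc y (right_face M (flip M e))"
      using that(2) unfolding face_flow_def by fastforce
    then have "right_face M (flip M e) = v\<^sub>0 \<or> right_face M e = v\<^sub>0"
      using that(1) out[of e] out[of "flip M e"] unfolding map_flip_flip primal.flip_in by metis
    with that(1) show ?thesis
      using root_face_iff[of e] root_face_iff[of "flip M e"] unfolding primal.flip_in by metis
  qed
  moreover have "d \<in> v\<^sub>0"
    using y parent_dart root_face_iff by blast
  ultimately have "face_flow ?S d = face_flow ?S (root_dart M)"
    by (rule face_flow_outer_constant)
  then show False
    using y t r parent_target[OF y(1)] by (simp add: face_flow_def)
qed

lemma tree_edge_at_root:
  assumes "d \<in> v\<^sub>0" "d \<noteq> root_dart M"
  shows "edge_of M d \<notin> T.tree_edges"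
proof
  assume "edge_of M d \<in> T.tree_edges"
  then show False
  proof (cases rule: tree_edge_cases)
    case 1
    then show ?thesis using root_has_one_child assms root_face_iff by blast
  next
    case 2
    then show ?thesis using T.root_None assms root_face_iff by simp
  qed
qed

text \<open>
  The complement of the tree is connected: a set of vertices closed under it has a flow carried
  by the tree, which is zero.  By Euler's formula it has no more edges than a spanning tree.
\<close>

lemma complement_spanning_tree:
  obtains Q where "spanning_tree M (root_vertex M) Q"
    "edge_of M ` ran Q = edge_set M - T.tree_edges"
proof (rule primal.spanning_tree_exists)
  show "root_vertex M \<in> vertex_set M" by simp
  show "edge_set M - T.tree_edges \<subseteq> edge_set M" by blast
  have T: "T.tree_edges \<subseteq> edge_set M"
    using parent_dart by (auto simp: ran_def)
  have "card T.tree_edges + 1 = card (face_set M)"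
    using T.card_spanning_tree by simp
  moreover have "card (edge_set M - T.tree_edges) = card (edge_set M) - card T.tree_edges"
    using T finite_subset[OF T primal.finite_edges] by (intro card_Diff_subset) auto
  moreover have "card (vertex_set M) + card (face_set M) = card (edge_set M) + 2"
    using planar by (simp add: rooted_planar_map_def)
  ultimately show "card (edge_set M - T.tree_edges) < card (vertex_set M)"
    using card_mono[OF primal.finite_edges T] by linarith
  show "A = vertex_set M" if A: "root_vertex M \<in> A" "A \<subseteq> vertex_set M"
    "\<And>d. d \<in> darts M \<Longrightarrow> edge_of M d \<in> edge_set M - T.tree_edges \<Longrightarrow> origin M d \<in> A \<Longrightarrow>
       target M d \<in> A" for A
  proof -
    have "vertex_flow A d = 0" if d: "d \<in> darts M" for d
    proof (rule T.circulation_supported_on_tree[OF circulation_vertex_flow])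
      show "vertex_flow A e = 0" if "e \<in> darts (dual M)" "edge_of (dual M) e \<notin> edge_of (dual M) ` ran P" for e
        using A(3)[of e] A(3)[of "flip M e"] that by (auto simp: vertex_flow_eq_0_iff)
    qed (use d in simp)
    then show ?thesis
      using connected_primal[unfolded map_connected_def, rule_format, of A] A(1,2)
      by (auto simp: vertex_flow_eq_0_iff)
  qed
qed (rule that)

lemma darts_at_child:
  assumes p: "P v = Some p" and v: "v \<noteq> v\<^sub>0" and d: "d \<in> darts M" "right_face M d = v"
  shows "d = flip M p \<or> d = rot M p \<or> d = face_perm M (rot M p)"
    and "rot M p \<noteq> flip M p" "face_perm M (rot M p) \<noteq> flip M p" "face_perm M (rot M p) \<noteq> rot M p"
    and "origin M (rot M p) = origin M p" "target M (face_perm M (rot M p)) = target M p"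
    and "right_face M (rot M p) = v" "right_face M (face_perm M (rot M p)) = v"
proof -
  have fp: "flip M p \<in> darts M" "right_face M (flip M p) = v"
    using parent_dart[OF p] parent_target[OF p] by auto
  with v have "right_face M (flip M p) \<noteq> v\<^sub>0" by simp
  note 3 = triangle[OF fp(1) this, unfolded face_perm_flip]
  show "d = flip M p \<or> d = rot M p \<or> d = face_perm M (rot M p)"
    using 3(2)[of d] d fp by simp
  show "rot M p \<noteq> flip M p" "face_perm M (rot M p) \<noteq> flip M p" "face_perm M (rot M p) \<noteq> rot M p"
    using 3 by auto
  show "target M (face_perm M (rot M p)) = target M p"
    using origin_face_perm[of "face_perm M (rot M p)"] 3(1) by simp
qed (use parent_target[OF p] in simp_all)

text \<open>The third dart at \<open>v\<close> leads back to the parent, which is not below \<open>v\<close>.\<close>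

lemma child_dart:
  assumes p: "P v = Some p" and v: "v \<noteq> v\<^sub>0" and d: "P y = Some d" "right_face M d = v"
  shows "d = rot M p \<or> d = face_perm M (rot M p)"
proof -
  have "d \<noteq> flip M p"
  proof
    assume "d = flip M p"
    then have "y = right_face M p"
      using parent_target[OF d(1)] by simp
    moreover have "T.desc v y"
      using desc_step_iff[OF d(1), of v] d(2) by simp
    ultimately show False using parent_not_below[OF p] by simp
  qed
  then show ?thesis
    using darts_at_child(1)[OF p v parent_dart[OF d(1)] d(2)] by blast
qed

lemma desc_first_child:
  assumes "T.desc v w" "v \<noteq> w"
  obtains d where "P (right_face M (flip M d)) = Some d" "right_face M d = v"
    "T.desc (right_face M (flip M d)) w"
  using T.desc_child[OF assms] by auto

definition down_chord :: "'d \<Rightarrow> bool" where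
  "down_chord b \<longleftrightarrow> b \<in> darts M \<and> edge_of M b \<notin> T.tree_edges \<and>
     T.desc (right_face M b) (right_face M (flip M b))"

lemma down_chord_cases:
  assumes "b \<in> darts M" "edge_of M b \<notin> T.tree_edges"
  obtains "down_chord b" | "down_chord (flip M b)"
  using comparable[OF assms(1)] assms by (auto simp: down_chord_def)

text \<open>
  At the top of a chord, the parent edge, the chord and the edge to the child above its bottom
  exhaust the three edges.
\<close>

lemma down_chord_forward:
  assumes b: "down_chord b" and p: "P (right_face M b) = Some p" and v: "right_face M b \<noteq> v\<^sub>0"
  obtains d where "P (right_face M (flip M d)) = Some d" "right_face M d = right_face M b"
    "T.desc (right_face M (flip M d)) (right_face M (flip M b))"
    "b = rot M p \<and> d = face_perm M (rot M p) \<or> b = face_perm M (rot M p) \<and> d = rot M p"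
proof -
  have bD: "b \<in> darts M" "edge_of M b \<notin> T.tree_edges"
    "T.desc (right_face M b) (right_face M (flip M b))"
    using b by (auto simp: down_chord_def)
  obtain d where d: "P (right_face M (flip M d)) = Some d" "right_face M d = right_face M b"
    "T.desc (right_face M (flip M d)) (right_face M (flip M b))"
    using desc_first_child[OF bD(3) dual_loopless[OF bD(1)]] .
  have "b \<noteq> flip M p"
    using bD(2) tree_edgeI[OF p] by auto
  moreover have "b \<noteq> d"
    using bD(2) tree_edgeI[OF d(1)] by auto
  ultimately have "b = rot M p \<and> d = face_perm M (rot M p) \<or> b = face_perm M (rot M p) \<and> d = rot M p"
    using child_dart[OF p v d(1,2)] darts_at_child(1)[OF p v bD(1) refl] by blast
  with d show ?thesis by (rule that)
qed

end

locale tree_pair = dual_search_tree M P +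
    Q: spanning_tree M "origin M (root_dart M)" Q for M :: "'d rooted_map" and P Q +
  assumes complement: "Q.tree_edges = edge_set M - T.tree_edges"
begin

abbreviation subtree_flow :: "'d set \<Rightarrow> 'd \<Rightarrow> int" where
  "subtree_flow x \<equiv> vertex_flow {w. Q.desc x w}"

lemma subtree_flow_support:
  assumes x: "Q x = Some e" and d: "d \<in> darts M" "subtree_flow x d \<noteq> 0"
  shows "edge_of M d \<in> T.tree_edges \<or> edge_of M d = edge_of M e"
proof (cases "edge_of M d \<in> T.tree_edges")
  case False
  then have Qd: "edge_of M d \<in> Q.tree_edges"
    using d by (auto simp: complement)
  have "Q.desc x (origin M d) \<noteq> Q.desc x (target M d)"
    using d(2) unfolding vertex_flow_eq_0_iff by simp
  then have "Q x = Some d \<or> Q x = Some (flip M d)"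
    using Qd Q.tree_edge_leaving_subtree[of d x] Q.tree_edge_leaving_subtree[of "flip M d" x]
    unfolding primal.edge_of_flip primal.origin_flip primal.target_flip map_flip_flip by metis
  with x show ?thesis by auto
qed simp

text \<open>
  If \<open>x\<close> hangs from an inner edge, the subtree at \<open>x\<close> avoids the outer vertices: no outer edge
  other than the root-edge crosses its boundary, hence the root-edge does not either.
\<close>

lemma subtree_of_inner_edge:
  assumes x: "Q x = Some e" and e: "right_face M e \<noteq> v\<^sub>0" "right_face M (flip M e) \<noteq> v\<^sub>0"
    and d: "d \<in> v\<^sub>0"
  shows "\<not> Q.desc x (origin M d)"
proof -
  have zero: "subtree_flow x d = 0" if d: "d \<in> v\<^sub>0" "d \<noteq> root_dart M" for d
  proof (rule ccontr)
    assume "subtree_flow x d \<noteq> 0"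
    then have "edge_of M d = edge_of M e"
      using subtree_flow_support[OF x] tree_edge_at_root[OF d] d root_face_iff by blast
    then have "e = d \<or> e = flip M d"
      by (simp add: primal.edge_of_eq_iff)
    moreover have "right_face M d = v\<^sub>0"
      using d root_face_iff by blast
    ultimately show False
      using e by (elim disjE) simp_all
  qed
  have root: "\<not> Q.desc x (root_vertex M)"
    using x Q.root_None Q.desc_root_iff by auto
  have "{d \<in> darts (dual M). origin (dual M) d = v\<^sub>0} = v\<^sub>0"
    using root_face_iff by auto
  moreover have "v\<^sub>0 \<in> vertex_set (dual M)" by simp
  ultimately have "sum (subtree_flow x) v\<^sub>0 = 0"
    using circulation_vertex_flow[of "{w. Q.desc x w}"] unfolding dual.circulation_def by metis
  moreover have "sum (subtree_flow x) v\<^sub>0 = sum (subtree_flow x) {root_dart M}"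
  proof (intro sum.mono_neutral_right ballI)
    have "v\<^sub>0 \<subseteq> darts M" using root_face_iff by blast
    then show "finite v\<^sub>0" using finite_map_darts finite_subset by blast
    show "{root_dart M} \<subseteq> v\<^sub>0" using root_face_iff[of "root_dart M"] by simp
  qed (use zero in blast)
  ultimately have "subtree_flow x (root_dart M) = 0" by simp
  with zero have step: "Q.desc x (origin M d) \<longleftrightarrow> Q.desc x (target M d)" if "d \<in> v\<^sub>0" for d
    using that by (cases "d = root_dart M") (auto simp: vertex_flow_eq_0_iff)
  have "d \<in> orbit (face_perm M) (root_dart M)"
    using d by (simp add: right_face_def)
  then have "d \<in> v\<^sub>0 \<and> \<not> Q.desc x (origin M d)"
  proof induction
    case base
    then show ?case using step[of "root_dart M"] root by (auto simp: root_face_iff)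
  next
    case (step e)
    then show ?case
      using \<open>\<And>d. d \<in> v\<^sub>0 \<Longrightarrow> Q.desc x (origin M d) \<longleftrightarrow> Q.desc x (target M d)\<close>[of e]
      by (auto simp: root_face_iff)
  qed
  then show ?thesis by blast
qed

text \<open>
  The topological heart of the bijection.  The subtree at \<open>x\<close> is bounded by the cycle that the
  chord \<open>b\<close> closes in the dual tree, on the side that does not contain \<open>v\<^sub>0\<close>.  Descending from
  \<open>v\<^sub>0\<close>, the tree stays outside this cycle until it meets it at the top of \<open>b\<close>, so of the three
  faces there, the two along the parent edge lie outside, and \<open>x\<close> is the forward face.
\<close>

lemma chord_forward_face:
  assumes b: "down_chord b" and p: "P (right_face M b) = Some p" and v: "right_face M b \<noteq> v\<^sub>0"
  shows "target M (rot M p) \<in> inner_vertices M"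
    and "\<exists>e. Q (target M (rot M p)) = Some e \<and> edge_of M e = edge_of M b"
proof -
  have bD: "b \<in> darts M" "edge_of M b \<notin> T.tree_edges"
    "T.desc (right_face M b) (right_face M (flip M b))"
    using b by (auto simp: down_chord_def)
  then have "edge_of M b \<in> Q.tree_edges"
    by (simp add: complement)
  then obtain x e where x: "Q x = Some e" and e: "edge_of M e = edge_of M b"
    by (auto simp: ran_def)
  have eb: "e = b \<or> e = flip M b"
    using e by (simp add: primal.edge_of_eq_iff) (metis map_flip_flip)
  note xe = Q.parent_target[OF x] Q.parent_not_below[OF x]
  have root: "\<not> Q.desc x (root_vertex M)"
    using x Q.root_None Q.desc_root_iff by auto
  have zero: "Q.desc x (origin M d) \<longleftrightarrow> Q.desc x (target M d)"
    if y: "P y = Some d" "T.desc y (right_face M b)" for y d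
  proof -
    have "subtree_flow x d' = 0"
      if "d' \<in> darts M" "T.desc y (right_face M d')" "\<not> T.desc y (right_face M (flip M d'))"
        "edge_of M d' \<notin> T.tree_edges" for d'
    proof (rule ccontr)
      assume "subtree_flow x d' \<noteq> 0"
      then have "edge_of M d' = edge_of M b"
        using subtree_flow_support[OF x] that e by auto
      then have "d' = b \<or> d' = flip M b"
        by (simp add: primal.edge_of_eq_iff) (metis map_flip_flip)
      with that y(2) descends_trans[OF y(2) bD(3)] show False by auto
    qed
    then have "subtree_flow x d = 0"
      using T.circulation_subtree[OF circulation_vertex_flow[of "{w. Q.desc x w}"] y(1)]
      by (simp add: sum.neutral)
    then show ?thesis by (simp add: vertex_flow_eq_0_iff)
  qed
  have outside: "\<not> Q.desc x (origin M d) \<and> \<not> Q.desc x (target M d)"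
    if "P y = Some d" "T.desc y (right_face M b)" for y d
    using that
  proof (induction "T.depth y" arbitrary: y d rule: less_induct)
    case less
    show ?case
    proof (cases "right_face M d = v\<^sub>0")
      case True
      then have "d = root_dart M"
        using root_has_one_child less.prems by blast
      with root zero[OF less.prems] show ?thesis by simp
    next
      case False
      let ?z = "right_face M d"
      have "?z \<in> insert v\<^sub>0 (dom P)"
        using T.parent_origin[OF less.prems(1)] by simp
      with False obtain d' where d': "P ?z = Some d'" by auto
      have z: "T.desc ?z y"
        using desc_step_iff[OF less.prems(1), of ?z] by simp
      have IH: "\<not> Q.desc x (origin M d')" "\<not> Q.desc x (target M d')"
        using less.hyps[OF _ d' descends_trans[OF z less.prems(2)]] T.depth_parent[OF less.prems(1)]
        unfolding origin_dual_eq by blast+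
      have "d = rot M d' \<or> d = face_perm M (rot M d')"
        using child_dart[OF d' False less.prems(1) refl] .
      then have "origin M d = origin M d' \<or> target M d = target M d'"
        using darts_at_child(5,6)[OF d' False parent_dart[OF less.prems(1)] refl] by (elim disjE) simp_all
      with IH zero[OF less.prems] show ?thesis by (elim disjE) simp_all
    qed
  qed
  have p_out: "\<not> Q.desc x (origin M p)" "\<not> Q.desc x (target M p)"
    using outside[OF p] by simp_all
  have cross: "Q.desc x (origin M b) \<noteq> Q.desc x (target M b)"
    using eb xe by (elim disjE) simp_all
  note at_p = darts_at_child[OF p v bD(1) refl]
  obtain d where "b = rot M p \<and> d = face_perm M (rot M p) \<or> b = face_perm M (rot M p) \<and> d = rot M p"
    using down_chord_forward[OF b p v] by blast
  then have "Q.desc x (target M (rot M p)) \<and>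
      (target M (rot M p) = origin M b \<or> target M (rot M p) = target M b)"
    using at_p(5,6) cross p_out by (elim disjE) simp_all
  then have x_eq: "x = target M (rot M p)"
    using eb xe by (metis primal.origin_flip primal.target_flip)
  then show "\<exists>e. Q (target M (rot M p)) = Some e \<and> edge_of M e = edge_of M b"
    using x e by auto
  have "right_face M (flip M b) \<noteq> v\<^sub>0"
    using bD(3) v T.desc_root_iff by auto
  then have "\<not> Q.desc x (origin M d)" if "d \<in> v\<^sub>0" for d
    using subtree_of_inner_edge[OF x _ _ that] eb v by (elim disjE) simp_all
  then have "x \<notin> outer_vertices M"
    unfolding outer_vertices_def by (metis descends_refl imageE)
  moreover have "x \<in> vertex_set M"
    using x Q.in_vertices[of x] by auto
  ultimately show "target M (rot M p) \<in> inner_vertices M"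
    by (simp add: inner_vertices_def x_eq)
qed

text \<open>
  Read in the map, the clockwise order \<open>flip a\<close>, \<open>d\<close>, \<open>b\<close> around a triangle is given by \<open>rot\<close> and
  \<open>face_perm\<close>.
\<close>

lemma left_of_tree_path_iff:
  "left_of_tree_path (dual M) T.tree_edges v\<^sub>0 d \<longleftrightarrow>
    (\<exists>a b. P (right_face M (flip M a)) = Some a \<and> P (right_face M (flip M b)) = Some b \<and>
       right_face M (flip M a) = right_face M b \<and>
       T.desc (right_face M (flip M b)) (right_face M (flip M d)) \<and>
       right_face M b = right_face M d \<and> d = rot M a \<and> b = face_perm M d)"
proof -
  have "left_of_tree_path (dual M) T.tree_edges v\<^sub>0 d \<longleftrightarrow>
    (\<exists>a b. (\<exists>ps qs. dual.path T.tree_edges v\<^sub>0 (ps @ [a, b] @ qs) (target (dual M) d)) \<and>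
      target (dual M) a = origin (dual M) d \<and> inv (rot (dual M)) (flip (dual M) a) = d \<and>
      inv (rot (dual M)) d = b)"
    unfolding left_of_tree_path_def by blast
  then show ?thesis
    unfolding T.path_through_iff target_dual_eq origin_dual_eq dual_simps face_perm_flip
    by metis
qed

text \<open>
  Of the two orientations of the parent edge of the forward face, only \<open>b\<close> goes from ancestor to
  descendant, and it is on the left of the tree path exactly if it is the left forward dart.
\<close>

lemma Lambda_chord:
  assumes b: "down_chord b" and p: "P (right_face M b) = Some p" and v: "right_face M b \<noteq> v\<^sub>0"
  shows "Lambda M T.tree_edges (target M (rot M p)) = (if b = rot M p then White else Black)"
proof -
  let ?x = "target M (rot M p)"
  obtain e where x: "Q ?x = Some e" and e: "edge_of M e = edge_of M b"
    using chord_forward_face(2)[OF b p v] by blast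
  have xt: "target M e = ?x" using Q.parent_target[OF x] .
  have bD: "b \<in> darts M" "T.desc (right_face M b) (right_face M (flip M b))"
    using b by (auto simp: down_chord_def)
  have eb: "edge_of M e = {b, flip M b}"
    using e by (simp add: edge_of_def)
  have comp: "dual_tree M T.tree_edges = Q.tree_edges"
    by (simp add: dual_tree_def complement)
  have "(\<exists>d d'. tree_dart M (dual_tree M T.tree_edges) (root_vertex M) d \<and> target M d = ?x \<and>
      d' \<in> edge_of M d \<and> left_of_tree_path (dual M) T.tree_edges v\<^sub>0 d') \<longleftrightarrow>
    (\<exists>d'\<in>{b, flip M b}. left_of_tree_path (dual M) T.tree_edges v\<^sub>0 d')"
    (is "?L \<longleftrightarrow> ?R")
  proof -
    have "?L \<longleftrightarrow> (\<exists>d. (Q (target M d) = Some d \<and> target M d = ?x) \<and>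
        (\<exists>d'\<in>edge_of M d. left_of_tree_path (dual M) T.tree_edges v\<^sub>0 d'))"
      unfolding comp Q.tree_dart_iff by blast
    moreover have "Q (target M d) = Some d \<and> target M d = ?x \<longleftrightarrow> d = e" for d
      using x xt by auto
    ultimately show ?thesis
      using eb by simp
  qed
  also have "\<dots> \<longleftrightarrow> b = rot M p"
  proof
    assume "\<exists>d'\<in>{b, flip M b}. left_of_tree_path (dual M) T.tree_edges v\<^sub>0 d'"
    then obtain d' a c where d': "d' \<in> {b, flip M b}" and
      a: "P (right_face M (flip M a)) = Some a" "right_face M (flip M a) = right_face M c" and
      c: "P (right_face M (flip M c)) = Some c"
        "T.desc (right_face M (flip M c)) (right_face M (flip M d'))"
        "right_face M c = right_face M d'" "d' = rot M a"
      unfolding left_of_tree_path_iff by blast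
    have "T.desc (right_face M d') (right_face M (flip M d'))"
      using desc_step_iff[OF c(1), of "right_face M d'"] c(2,3) descends_trans by fastforce
    with bD d' have "d' = b"
      using T.desc_antisym[of "right_face M b" "right_face M (flip M b)"] dual_loopless[of b] by auto
    then show "b = rot M p"
      using a c(3,4) p by simp
  next
    assume *: "b = rot M p"
    obtain d where d: "P (right_face M (flip M d)) = Some d" "right_face M d = right_face M b"
      "T.desc (right_face M (flip M d)) (right_face M (flip M b))"
      "b = rot M p \<and> d = face_perm M (rot M p) \<or> b = face_perm M (rot M p) \<and> d = rot M p"
      using down_chord_forward[OF b p v] .
    then have "d = face_perm M b"
      using * darts_at_child(4)[OF p v bD(1) refl] by metis
    moreover have "P (right_face M (flip M p)) = Some p" "right_face M (flip M p) = right_face M d"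
      using p parent_target[OF p] d(2) by simp_all
    ultimately have "left_of_tree_path (dual M) T.tree_edges v\<^sub>0 b"
      unfolding left_of_tree_path_iff using d(1,2,3) * by blast
    then show "\<exists>d'\<in>{b, flip M b}. left_of_tree_path (dual M) T.tree_edges v\<^sub>0 d'" by blast
  qed
  finally show ?thesis
    using chord_forward_face(1)[OF b p v] by (simp add: Lambda_def)
qed

end

section \<open>The two mappings are inverse bijections\<close>

context planar_map
begin

lemma forward_face_coloring: "face_coloring M s (forward_face (dual M) p) = s (target M (rot M p))"
  by (simp add: face_coloring_def forward_face_def left_forward_def right_face_dual[OF planar] image_image)

definition forward_choice :: "('d set \<Rightarrow> color) \<Rightarrow> 'd \<Rightarrow> 'd" where
  "forward_choice c p = (case outer_white M c (target M (rot M p)) of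
     Black \<Rightarrow> rot M p | White \<Rightarrow> face_perm M (rot M p))"

lemma Delta_choice_iff:
  "Delta_choice M c u X P d \<longleftrightarrow> (X = {v\<^sub>0} \<longrightarrow> d = root_dart M) \<and>
     (u \<noteq> v\<^sub>0 \<and> card (forward_darts (dual M) X u) \<ge> 2 \<longrightarrow> d = forward_choice c (the (P u)))"
proof -
  have left: "left_forward (dual M) = rot M"
    and right: "right_forward (dual M) = (\<lambda>p. face_perm M (rot M p))"
    by (simp_all add: fun_eq_iff left_forward_def right_forward_def)
  show ?thesis
    unfolding Delta_choice_def forward_choice_def forward_face_coloring left right by simp
qed

end

context boundary_triangulation
begin

abbreviation delta_reaches ::
    "('d set \<Rightarrow> color) \<Rightarrow> 'd set \<Rightarrow> 'd set set \<Rightarrow> ('d set \<rightharpoonup> 'd) \<Rightarrow> bool" where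
  "delta_reaches c \<equiv> dfs_reaches (dual M) v\<^sub>0 (Delta_choice M c)"

lemma root_face_is_dual_vertex: "v\<^sub>0 \<in> vertex_set (dual M)"
  by simp

text \<open>
  The parent of \<open>u\<close> being visited, only the two other darts of the triangle can go forward.
\<close>

lemma forward_dart_cases:
  assumes p: "p \<in> darts M" "right_face M (flip M p) = u" "right_face M p \<in> X" and u: "u \<noteq> v\<^sub>0"
    and d: "d \<in> forward_darts (dual M) X u"
  shows "d = rot M p \<or> d = face_perm M (rot M p)"
proof -
  have d': "d \<in> darts M" "right_face M d = u" "right_face M (flip M d) \<notin> X"
    using dual.forward_dartsD[OF d] by auto
  have "d \<noteq> flip M p"
    using d'(3) p(3) by auto
  then show ?thesis
    using triangle(2)[of "flip M p" d] p u d' by simp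
qed

lemma Delta_choice_possible:
  assumes reach: "delta_reaches c u X P" and ne: "forward_darts (dual M) X u \<noteq> {}"
  shows "\<exists>d \<in> forward_darts (dual M) X u. Delta_choice M c u X P d"
proof -
  note inv = dual.dfs_invariant[OF reach root_face_is_dual_vertex]
  interpret R: rooted_tree "dual M" "v\<^sub>0" P using inv by blast
  show ?thesis
  proof (cases "u = v\<^sub>0")
    case True
    have "root_dart M \<in> forward_darts (dual M) {v\<^sub>0} v\<^sub>0"
      using dual_loopless[of "root_dart M"] by (simp add: forward_darts_def)
    then show ?thesis
      using ne True by (cases "X = {v\<^sub>0}") (auto simp: Delta_choice_iff)
  next
    case False
    with inv obtain p where p: "P u = Some p" by auto
    have pD: "p \<in> darts M" "right_face M (flip M p) = u" "right_face M p \<in> X"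
      using R.parent_dart[OF p] R.parent_target[OF p] R.parent_origin[OF p] inv by auto
    let ?F = "forward_darts (dual M) X u"
    have X: "X \<noteq> {v\<^sub>0}" using inv False by blast
    show ?thesis
    proof (cases "card ?F \<ge> 2")
      case True
      \<comment> \<open>both darts are then possible, whichever the color selects\<close>
      have sub: "?F \<subseteq> {rot M p, face_perm M (rot M p)}"
        using forward_dart_cases[OF pD False] by blast
      have "card {rot M p, face_perm M (rot M p)} \<le> 2"
        by (simp add: card_insert_if)
      then have "?F = {rot M p, face_perm M (rot M p)}"
        using True by (intro card_seteq[OF _ sub]) auto
      then have "forward_choice c p \<in> ?F"
        by (auto simp: forward_choice_def split: color.split)
      with X p show ?thesis
        by (intro bexI[of _ "forward_choice c p"]) (simp_all add: Delta_choice_iff)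
    next
      assume "\<not> card ?F \<ge> 2"
      with ne X show ?thesis by (auto simp: Delta_choice_iff)
    qed
  qed
qed

text \<open>
  The first step goes along the dual of the root-edge, and later steps keep the parents of visited
  vertices.
\<close>

lemma delta_root_child:
  assumes "delta_reaches c u X P"
  shows "X = {v\<^sub>0} \<or> P (right_face M (flip M (root_dart M))) = Some (root_dart M)"
  using assms
proof induction
  case (forward u X P d)
  let ?t = "right_face M (flip M (root_dart M))"
  have z: "target (dual M) d \<notin> X"
    using dual.forward_dartsD[OF forward.hyps(2)] by blast
  have X: "X = insert v\<^sub>0 (dom P)"
    using dual.dfs_invariant[OF forward.hyps(1) root_face_is_dual_vertex] by blast
  from forward.IH show ?case
  proof
    assume "X = {v\<^sub>0}"
    then have "d = root_dart M" using forward.hyps(3) by (simp add: Delta_choice_iff)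
    then show ?thesis by simp
  next
    assume *: "P ?t = Some (root_dart M)"
    then have "?t \<in> X" using X by blast
    with z have "?t \<noteq> target (dual M) d" by metis
    with * show ?thesis by (simp del: target_dual_eq)
  qed
qed simp_all

text \<open>
  If the second forward dart \<open>d'\<close> at the origin of a parent dart \<open>d\<close> leads to a dual vertex
  that was unvisited when \<open>d\<close> was taken, then \<open>d\<close> was taken because of the color.  Otherwise this
  vertex stays outside the subtree below \<open>d\<close>, whose vertices are visited later.
\<close>

lemma delta_choice_invariant:
  assumes "delta_reaches c u X P"
    and "P y = Some d" "right_face M d \<noteq> v\<^sub>0" "d' \<in> darts M" "right_face M d' = right_face M d" "d' \<noteq> d"
  shows "right_face M (flip M d') \<in> X \<and> \<not> descends (dual M) P y (right_face M (flip M d')) \<or>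
    d = forward_choice c (the (P (right_face M d)))"
  using assms
proof (induction arbitrary: y d)
  case (forward u X P e)
  define z where "z = target (dual M) e"
  note inv = dual.dfs_invariant[OF forward.hyps(1) root_face_is_dual_vertex]
  interpret R: rooted_tree "dual M" "v\<^sub>0" P using inv by blast
  have X: "X = insert v\<^sub>0 (dom P)" and u: "u \<in> X" using inv by auto
  have e: "e \<in> darts M" "right_face M e = u" "z \<notin> X"
    using dual.forward_dartsD[OF forward.hyps(2)] by (auto simp: z_def)
  have leaf: "z \<notin> insert v\<^sub>0 (dom P)" "e \<in> darts (dual M)" "target (dual M) e = z"
    "origin (dual M) e \<in> insert v\<^sub>0 (dom P)"
    using e u X z_def by auto
  let ?w = "right_face M (flip M d')"
  have desc': "descends (dual M) (P(z \<mapsto> e)) y ?w \<longleftrightarrow> descends (dual M) P y ?w" if "?w \<in> X"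
  proof -
    have "?w \<noteq> z" using that e(3) by blast
    then show ?thesis using R.desc_add_leaf[OF leaf] by simp
  qed
  have "?w \<in> insert z X \<and> \<not> descends (dual M) (P(z \<mapsto> e)) y ?w \<or>
      d = forward_choice c (the ((P(z \<mapsto> e)) (right_face M d)))"
  proof (cases "y = z")
    case True
    then have d: "d = e" using forward.prems(1)[folded z_def] by simp
    have P: "(P(z \<mapsto> e)) u = P u" using u e(3) by auto
    show ?thesis
    proof (cases "?w \<in> X")
      case True
      then have "\<not> descends (dual M) P y ?w"
        using R.desc_in[of y ?w] X e(3) \<open>y = z\<close> by blast
      with True desc' show ?thesis by blast
    next
      case False
      then have "{e, d'} \<subseteq> forward_darts (dual M) X u"
        using e forward.prems d by (auto simp: forward_darts_def z_def)
      moreover have "finite (forward_darts (dual M) X u)"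
        by (simp add: forward_darts_def)
      ultimately have "card (forward_darts (dual M) X u) \<ge> 2"
        using card_mono[of "forward_darts (dual M) X u" "{e, d'}"] forward.prems(5) d by simp
      then have "e = forward_choice c (the (P u))"
        using forward.hyps(3) forward.prems(2) d e(2) by (simp add: Delta_choice_iff)
      then show ?thesis using d e(2) P by simp
    qed
  next
    case False
    then have y: "P y = Some d" using forward.prems(1)[folded z_def] by simp
    then have "right_face M d \<noteq> z"
      using R.parent_origin[OF y] X e(3) by auto
    then have P: "(P(z \<mapsto> e)) (right_face M d) = P (right_face M d)" by simp
    from forward.IH[OF y forward.prems(2-5)] show ?thesis
      unfolding P using desc' by blast
  qed
  then show ?case unfolding z_def .
qed simp_all

lemma search_treeI:
  assumes "dfs_reaches (dual M) v\<^sub>0 allowed v\<^sub>0 X P" "forward_darts (dual M) X v\<^sub>0 = {}"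
    and "P (right_face M (flip M (root_dart M))) = Some (root_dart M)"
  shows "dual_search_tree M P"
proof -
  interpret dfs_tree "dual M" "v\<^sub>0" P
    using dual.dfs_final_dfs_tree[OF assms(1,2) root_face_is_dual_vertex connected_dual] .
  show ?thesis
    by unfold_locales (rule assms(3))
qed

lemma delta_tree:
  assumes "T \<in> dfs_trees (dual M) v\<^sub>0 (Delta_choice M c)"
  obtains P where "dual_search_tree M P" "T = edge_of M ` ran P"
    "\<And>y d d'. P y = Some d \<Longrightarrow> right_face M d \<noteq> v\<^sub>0 \<Longrightarrow> d' \<in> darts M \<Longrightarrow>
      right_face M d' = right_face M d \<Longrightarrow> d' \<noteq> d \<Longrightarrow>
      descends (dual M) P y (right_face M (flip M d')) \<Longrightarrow>
      d = forward_choice c (the (P (right_face M d)))"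
proof -
  obtain X P where T: "T = edge_of M ` ran P" and reach: "delta_reaches c v\<^sub>0 X P"
    and stop: "forward_darts (dual M) X v\<^sub>0 = {}"
    using assms by (auto simp: dfs_trees_def)
  have "root_dart M \<in> forward_darts (dual M) {v\<^sub>0} v\<^sub>0"
    using dual_loopless[of "root_dart M"] by (simp add: forward_darts_def)
  with stop have "X \<noteq> {v\<^sub>0}" by blast
  then have "P (right_face M (flip M (root_dart M))) = Some (root_dart M)"
    using delta_root_child[OF reach] by blast
  then have "dual_search_tree M P"
    by (rule search_treeI[OF reach stop])
  then show ?thesis
  proof (rule that[OF _ T])
    show "d = forward_choice c (the (P (right_face M d)))"
      if "P y = Some d" "right_face M d \<noteq> v\<^sub>0" "d' \<in> darts M" "right_face M d' = right_face M d"
        "d' \<noteq> d" "descends (dual M) P y (right_face M (flip M d'))" for y d d'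
      using delta_choice_invariant[OF reach that(1-5)] that(6) by blast
  qed
qed

lemma search_trees_contain_root_edge:
  "{T \<in> dfs_trees (dual M) (root_vertex (dual M)) (\<lambda>_ _ _ _. True). root_edge (dual M) \<in> T} =
    {edge_of M ` ran P | P. dual_search_tree M P \<and>
       (\<exists>X. dfs_reaches (dual M) v\<^sub>0 (\<lambda>_ _ _ _. True) v\<^sub>0 X P \<and> forward_darts (dual M) X v\<^sub>0 = {})}"
  (is "?L = ?R")
proof (intro equalityI subsetI)
  fix T assume "T \<in> ?L"
  then obtain X P where T: "T = edge_of M ` ran P" "edge_of M (root_dart M) \<in> T"
    and reach: "dfs_reaches (dual M) v\<^sub>0 (\<lambda>_ _ _ _. True) v\<^sub>0 X P"
    and stop: "forward_darts (dual M) X v\<^sub>0 = {}"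
    by (auto simp: dfs_trees_def)
  interpret R: rooted_tree "dual M" "v\<^sub>0" P
    using dual.dfs_invariant[OF reach root_face_is_dual_vertex] by blast
  have "P (right_face M (flip M (root_dart M))) = Some (root_dart M)"
    using R.tree_edge_cases[of "root_dart M"] T R.root_None by auto
  then show "T \<in> ?R"
    using search_treeI[OF reach stop] T reach stop by blast
next
  fix T assume "T \<in> ?R"
  then obtain X P where T: "T = edge_of M ` ran P" and P: "dual_search_tree M P"
    and reach: "dfs_reaches (dual M) v\<^sub>0 (\<lambda>_ _ _ _. True) v\<^sub>0 X P"
    and stop: "forward_darts (dual M) X v\<^sub>0 = {}"
    by blast
  have "edge_of M (root_dart M) \<in> T"
    using dual_search_tree.root_child[OF P] T by (auto simp: ran_def)
  then show "T \<in> ?L"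
    using T reach stop by (auto simp: dfs_trees_def)
qed

lemma delta_tree_in_search_trees:
  assumes "T \<in> dfs_trees (dual M) v\<^sub>0 (Delta_choice M c)"
  shows "T \<in> {T \<in> dfs_trees (dual M) (root_vertex (dual M)) (\<lambda>_ _ _ _. True). root_edge (dual M) \<in> T}"
proof -
  obtain P where "dual_search_tree M P" and T: "T = edge_of M ` ran P"
    by (rule delta_tree[OF assms], rule that, assumption+)
  then have "edge_of M (root_dart M) \<in> T"
    using dual_search_tree.root_child by (fastforce simp: ran_def)
  moreover have "T \<in> dfs_trees (dual M) v\<^sub>0 (\<lambda>_ _ _ _. True)"
    using assms dfs_reaches_mono[where allowed = "Delta_choice M c" and allowed' = "\<lambda>_ _ _ _. True"]
    unfolding dfs_trees_def by blast
  ultimately show ?thesis by simp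
qed

text \<open>
  The parent edge of an inner vertex \<open>x\<close> in the complement is a chord of the search tree, with \<open>x\<close>
  as forward face of its top.  Both forward darts were possible there, so the color of \<open>x\<close> made the
  choice, and it is read off again from the side of the chord.
\<close>

lemma Lambda_of_delta_tree:
  assumes c: "c \<in> Perc M" and T: "T \<in> dfs_trees (dual M) v\<^sub>0 (Delta_choice M c)"
  shows "Lambda M T = c"
proof -
  obtain P where "dual_search_tree M P" and T: "T = edge_of M ` ran P" and
    choice: "\<And>y d d'. P y = Some d \<Longrightarrow> right_face M d \<noteq> v\<^sub>0 \<Longrightarrow> d' \<in> darts M \<Longrightarrow>
      right_face M d' = right_face M d \<Longrightarrow> d' \<noteq> d \<Longrightarrow>
      descends (dual M) P y (right_face M (flip M d')) \<Longrightarrow>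
      d = forward_choice c (the (P (right_face M d)))"
    by (rule delta_tree[OF T], rule that, assumption, assumption, blast)
  then interpret dual_search_tree M P by simp
  obtain Q where "spanning_tree M (root_vertex M) Q" "edge_of M ` ran Q = edge_set M - T.tree_edges"
    by (rule complement_spanning_tree)
  then interpret tree_pair M P Q
    by (simp add: tree_pair_def tree_pair_axioms_def dual_search_tree_axioms)
  show ?thesis
  proof
    fix x
    show "Lambda M T x = c x"
    proof (cases "x \<in> inner_vertices M")
      case False
      then have "c x = undefined"
        using c unfolding Perc_def by (intro PiE_arb)
      with False show ?thesis by (simp add: Lambda_def)
    next
      case x: True
      have outer: "origin M d \<noteq> x" "target M d \<noteq> x" if "d \<in> v\<^sub>0" for d
      proof -
        have "face_perm M d \<in> v\<^sub>0" using that root_face_iff by simp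
        then have "target M d \<in> outer_vertices M"
          unfolding outer_vertices_def using origin_face_perm[of d] by (metis imageI)
        then show "origin M d \<noteq> x" "target M d \<noteq> x"
          using x that by (auto simp: inner_vertices_def outer_vertices_def)
      qed
      have "root_dart M \<in> v\<^sub>0" using root_face_iff by simp
      then obtain e where e: "Q x = Some e" "e \<in> darts M" "target M e = x"
        using Q.parent_exists[of x] x outer(1) by (metis DiffD1 inner_vertices_def)
      have not_outer: "e \<notin> v\<^sub>0" "flip M e \<notin> v\<^sub>0"
        using outer[of e] outer[of "flip M e"] e(3) by (metis primal.origin_flip)+
      have chord: "edge_of M e \<notin> T.tree_edges"
        using e(1) complement by (auto simp: ran_def)
      have "down_chord e \<or> down_chord (flip M e)"
        using down_chord_cases[OF e(2) chord] by blast
      then obtain b where b: "down_chord b" and eb: "b = e \<or> b = flip M e"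
        by blast
      have bD: "b \<in> darts M" using b by (simp add: down_chord_def)
      have v: "right_face M b \<noteq> v\<^sub>0"
        using eb not_outer bD root_face_iff by metis
      obtain p where p: "P (right_face M b) = Some p"
        using T.parent_exists[OF _ v] bD by (metis right_face_in_faces vertex_set_dual)
      obtain e' where e': "Q (target M (rot M p)) = Some e'" "edge_of M e' = edge_of M b"
        using chord_forward_face(2)[OF b p v] by blast
      have "edge_of M e = edge_of M e'"
        using e'(2) eb by (elim disjE) simp_all
      then have xp: "x = target M (rot M p)"
        by (rule Q.parent_edge_inj[OF e(1) e'(1)])
      obtain d where d: "P (right_face M (flip M d)) = Some d" "right_face M d = right_face M b"
        "T.desc (right_face M (flip M d)) (right_face M (flip M b))"
        "b = rot M p \<and> d = face_perm M (rot M p) \<or> b = face_perm M (rot M p) \<and> d = rot M p"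
        using down_chord_forward[OF b p v] .
      have neq: "face_perm M (rot M p) \<noteq> rot M p"
        using darts_at_child(4)[OF p v bD refl] .
      have "b \<noteq> d" using d(4) neq by metis
      moreover have "right_face M d \<noteq> v\<^sub>0" using v unfolding d(2) .
      ultimately have "d = forward_choice c (the (P (right_face M d)))"
        using choice[OF d(1) _ bD d(2)[symmetric] _ d(3)] by blast
      then have "d = forward_choice c p"
        unfolding d(2) p option.sel .
      then have "d = (case c x of Black \<Rightarrow> rot M p | White \<Rightarrow> face_perm M (rot M p))"
        using x by (simp add: forward_choice_def outer_white_def xp)
      then have "c x = (if b = rot M p then White else Black)"
        using d(4) neq by (auto split: color.splits)
      then show ?thesis
        using Lambda_chord[OF b p v] xp T by simp
    qed
  qed
qed

end

context dual_search_tree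
begin

text \<open>
  With two possible darts of which one is a chord, the color given to the forward face sends the
  search along the other one, which belongs to the tree.
\<close>

lemma Delta_choice_in_tree:
  assumes reach: "delta_reaches (Lambda M T.tree_edges) u X P'" and sub: "P' \<subseteq>\<^sub>m P"
    and d: "d \<in> forward_darts (dual M) X u"
    and choice: "Delta_choice M (Lambda M T.tree_edges) u X P' d"
  shows "P (right_face M (flip M d)) = Some d"
proof (rule ccontr)
  assume not_tree: "P (right_face M (flip M d)) \<noteq> Some d"
  note inv = dual.dfs_invariant[OF reach root_face_is_dual_vertex]
  interpret R: rooted_tree "dual M" "v\<^sub>0" P' using inv by blast
  have X: "X = insert v\<^sub>0 (dom P')" "u \<in> X" using inv by auto
  have agree: "P v = Some d" if "P' v = Some d" for v d
    using sub that by (auto simp: map_le_def dom_def)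
  obtain e where e: "e \<in> forward_darts (dual M) X u" "P (target (dual M) e) = Some e"
    "T.desc (target (dual M) e) (target (dual M) d)"
    using T.forward_dart_tree_child[OF reach sub d] .
  have dD: "d \<in> darts M" "right_face M d = u" "right_face M (flip M d) \<notin> X"
    using dual.forward_dartsD[OF d] by auto
  have eD: "e \<in> darts M" "right_face M e = u" "right_face M (flip M e) \<notin> X"
    using dual.forward_dartsD[OF e(1)] by auto
  have de: "d \<noteq> e" using not_tree e(2) by auto
  show False
  proof (cases "u = v\<^sub>0")
    case True
    then have e0: "e = root_dart M"
      using root_has_one_child[OF e(2)] eD by simp
    \<comment> \<open>any other visited vertex would be below the only child of \<open>v\<^sub>0\<close>, which is unvisited\<close>
    have "X = {v\<^sub>0}"
    proof (rule ccontr)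
      assume "X \<noteq> {v\<^sub>0}"
      then obtain x where x: "x \<in> X" "x \<noteq> v\<^sub>0" using X by auto
      then have "R.desc v\<^sub>0 x" using R.root_desc X by blast
      then obtain a where a: "P' (target (dual M) a) = Some a" "origin (dual M) a = v\<^sub>0"
        using R.desc_child x(2) by metis
      then have "a = root_dart M"
        using root_has_one_child[OF agree[OF a(1)]] by simp
      then have "right_face M (flip M e) \<in> X"
        using a(1) e0 X by auto
      with eD show False by simp
    qed
    then have "d = root_dart M"
      using choice by (simp add: Delta_choice_iff)
    with e0 de show False by simp
  next
    case u: False
    with X obtain p where p': "P' u = Some p" by auto
    then have p: "P (right_face M d) = Some p" using agree dD by simp
    have chord: "edge_of M d \<notin> T.tree_edges"
    proof
      assume "edge_of M d \<in> T.tree_edges"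
      then show False
      proof (cases rule: tree_edge_cases)
        case 2
        then have "flip M d = p" using p by simp
        then have "right_face M (flip M d) \<in> X"
          using R.parent_origin[OF p'] X by auto
        with dD show False by simp
      qed (use not_tree in simp)
    qed
    have "T.desc u (right_face M (flip M e))"
      using e(2) eD desc_step_iff[of "right_face M (flip M e)" e u] by simp
    then have b: "down_chord d"
      using e(3) dD chord descends_trans unfolding down_chord_def by fastforce
    have v: "right_face M d \<noteq> v\<^sub>0" using u dD by simp
    obtain Q where "spanning_tree M (root_vertex M) Q" "edge_of M ` ran Q = edge_set M - T.tree_edges"
      by (rule complement_spanning_tree)
    then interpret tree_pair M P Q
      by (simp add: tree_pair_def tree_pair_axioms_def dual_search_tree_axioms)
    have "{d, e} \<subseteq> forward_darts (dual M) X u" using d e by blast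
    moreover have "finite (forward_darts (dual M) X u)"
      by (simp add: forward_darts_def)
    ultimately have "card (forward_darts (dual M) X u) \<ge> 2"
      using card_mono[of "forward_darts (dual M) X u" "{d, e}"] de by simp
    then have "d = forward_choice (Lambda M T.tree_edges) p"
      using choice u p' by (simp add: Delta_choice_iff)
    also have "\<dots> = (if d = rot M p then face_perm M (rot M p) else rot M p)"
      using chord_forward_face(1)[OF b p v] Lambda_chord[OF b p v]
      by (simp add: forward_choice_def outer_white_def)
    finally show False
      using darts_at_child(4)[OF p v dD(1) refl] by (simp split: if_splits)
  qed
qed

lemma delta_tree_of_Lambda:
  assumes "T \<in> dfs_trees (dual M) v\<^sub>0 (Delta_choice M (Lambda M T.tree_edges))"
  shows "T = T.tree_edges"
proof -
  obtain X P' where T: "T = edge_of M ` ran P'"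
    and reach: "delta_reaches (Lambda M T.tree_edges) v\<^sub>0 X P'"
    and stop: "forward_darts (dual M) X v\<^sub>0 = {}"
    using assms by (auto simp: dfs_trees_def)
  have "P' \<subseteq>\<^sub>m P"
  proof (rule T.dfs_follows_tree[OF reach])
    show "P (target (dual M) d) = Some d"
      if "delta_reaches (Lambda M T.tree_edges) u X P'" "P' \<subseteq>\<^sub>m P" "d \<in> forward_darts (dual M) X u"
        "Delta_choice M (Lambda M T.tree_edges) u X P' d" for u X P' d
      using Delta_choice_in_tree[OF that] by simp
  qed
  interpret T': dfs_tree "dual M" "v\<^sub>0" P'
    using dual.dfs_final_dfs_tree[OF reach stop root_face_is_dual_vertex connected_dual] .
  have "dom P' = dom P"
    using T'.spanning T.spanning T'.root_None T.root_None by (metis Diff_insert_absorb domIff)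
  with \<open>P' \<subseteq>\<^sub>m P\<close> have "P' = P"
    by (metis map_le_antisym map_le_def)
  with T show ?thesis by simp
qed

end

context boundary_triangulation
begin

text \<open>
  That the directed search determines its tree needs no discussion of its steps: two trees of
  searches directed by \<open>c\<close> are both sent to \<open>c\<close> by \<open>\<Lambda>\<close>, and every search directed by \<open>\<Lambda>(\<tau>)\<close> gives \<open>\<tau>\<close>.
\<close>

lemma Delta_in_dfs_trees:
  assumes c: "c \<in> Perc M"
  shows "Delta M c \<in> dfs_trees (dual M) v\<^sub>0 (Delta_choice M c)"
proof -
  have "\<exists>X P. delta_reaches c v\<^sub>0 X P \<and> forward_darts (dual M) X v\<^sub>0 = {}"
    by (rule dual.dfs_terminates[OF root_face_is_dual_vertex Delta_choice_possible])
  then have ex: "\<exists>T. T \<in> dfs_trees (dual M) v\<^sub>0 (Delta_choice M c)"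
    unfolding dfs_trees_def by blast
  have unique: "T' = T" if T: "T \<in> dfs_trees (dual M) v\<^sub>0 (Delta_choice M c)"
    and T': "T' \<in> dfs_trees (dual M) v\<^sub>0 (Delta_choice M c)" for T T'
  proof -
    obtain P where P: "dual_search_tree M P" "T = edge_of M ` ran P"
      by (rule delta_tree[OF T], rule that, assumption+)
    have "Lambda M (edge_of M ` ran P) = c"
      using Lambda_of_delta_tree[OF c T] P(2) by simp
    with dual_search_tree.delta_tree_of_Lambda[OF P(1), of T'] T' P(2) show ?thesis by simp
  qed
  have "Delta M c = (THE T. T \<in> dfs_trees (dual M) v\<^sub>0 (Delta_choice M c))"
    by (simp add: Delta_def)
  with ex unique show ?thesis
    by (metis (mono_tags, lifting) theI)
qed

lemma Delta_search_tree:
  assumes "c \<in> Perc M"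
  obtains P where "dual_search_tree M P" "Delta M c = edge_of M ` ran P"
  by (rule delta_tree[OF Delta_in_dfs_trees[OF assms]], rule that, assumption+)

lemma Lambda_Delta: "c \<in> Perc M \<Longrightarrow> Lambda M (Delta M c) = c"
  by (rule Lambda_of_delta_tree[OF _ Delta_in_dfs_trees])

lemma Lambda_in_Perc: "Lambda M T \<in> Perc M"
  by (simp add: Lambda_def Perc_def)

lemma Delta_Lambda:
  assumes "dual_search_tree M P"
  shows "Delta M (Lambda M (edge_of M ` ran P)) = edge_of M ` ran P"
  using dual_search_tree.delta_tree_of_Lambda[OF assms, OF Delta_in_dfs_trees[OF Lambda_in_Perc]]
  by simp

lemma bijections:
  assumes "\<not> single_edge M"
  shows "bij_betw (Delta M) (Perc M) (DFS M)" "bij_betw (Lambda M) (DFS M) (Perc M)"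
    "\<forall>T \<in> DFS M. Delta M (Lambda M T) = T"
proof -
  have DFS: "DFS M = {T \<in> dfs_trees (dual M) (root_vertex (dual M)) (\<lambda>_ _ _ _. True).
      root_edge (dual M) \<in> T}"
    using assms unfolding DFS_def by simp
  have to_DFS: "Delta M ` Perc M \<subseteq> DFS M"
    using delta_tree_in_search_trees[OF Delta_in_dfs_trees] unfolding DFS by blast
  show Delta_Lambda': "\<forall>T \<in> DFS M. Delta M (Lambda M T) = T"
    unfolding DFS search_trees_contain_root_edge using Delta_Lambda by blast
  have to_Perc: "Lambda M ` DFS M \<subseteq> Perc M"
    using Lambda_in_Perc by blast
  show "bij_betw (Delta M) (Perc M) (DFS M)"
    by (rule bij_betw_byWitness[where f' = "Lambda M"])
      (use Lambda_Delta Delta_Lambda' to_DFS to_Perc in blast)+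
  show "bij_betw (Lambda M) (DFS M) (Perc M)"
    by (rule bij_betw_byWitness[where f' = "Delta M"])
      (use Lambda_Delta Delta_Lambda' to_DFS to_Perc in blast)+
qed

end

section \<open>Percolation interfaces\<close>

context planar_map
begin

abbreviation white_flow :: "('d set \<Rightarrow> color) \<Rightarrow> 'd \<Rightarrow> int" where
  "white_flow s \<equiv> vertex_flow {v. s v = White}"

lemma left_face_coloring: "face_coloring M s (left_face (dual M) d) = s (origin M d)"
  by (simp add: face_coloring_def left_face_dual[OF planar] image_image)

lemma bicolored_iff: "bicolored M s d \<longleftrightarrow> white_flow s d \<noteq> 0"
proof -
  have "bicolored M s d \<longleftrightarrow> s (origin M d) \<noteq> s (target M d)"
    by (simp add: bicolored_def face_coloring_def left_face_dual[OF planar] right_face_dual[OF planar]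
        image_image)
  then show ?thesis
    by (cases "s (origin M d)"; cases "s (target M d)") (simp_all add: vertex_flow_def)
qed

lemma interface_dart:
  assumes "dual.walk (interface_edges M s) u p v" "d \<in> set p"
  shows "d \<in> darts M" "white_flow s d \<noteq> 0" "right_face M d \<noteq> v\<^sub>0" "right_face M (flip M d) \<noteq> v\<^sub>0"
proof -
  have d: "d \<in> darts M" "edge_of M d \<in> interface_edges M s"
    using dual.walk_dart[OF assms] by simp_all
  then obtain e where e: "edge_of M d = edge_of M e" "e \<in> darts M" "white_flow s e \<noteq> 0"
    "right_face M e \<noteq> v\<^sub>0" "right_face M (flip M e) \<noteq> v\<^sub>0"
    unfolding interface_edges_def bicolored_iff by auto
  have flip: "white_flow s (flip M e) = - white_flow s e"
    using dual.circulation_flip[OF circulation_vertex_flow, of e] e(2) by simp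
  have "e = d \<or> e = flip M d"
    using e(1) by (simp add: primal.edge_of_eq_iff)
  then have "d = e \<or> d = flip M e" by auto
  with e flip show "white_flow s d \<noteq> 0" "right_face M d \<noteq> v\<^sub>0" "right_face M (flip M d) \<noteq> v\<^sub>0"
    by (elim disjE; simp)+
  show "d \<in> darts M" using d(1) .
qed

end

lemma (in dart_graph) walk_within:
  assumes "walk S u p v" "\<And>d. d \<in> set p \<Longrightarrow> K (origin G d) \<longleftrightarrow> K (target G d)"
    and "d \<in> set p"
  shows "K (origin G d) \<longleftrightarrow> K u"
  using assms
proof (induction p arbitrary: u)
  case (Cons e p)
  have "K (origin G d) \<longleftrightarrow> K (target G e)" if "d \<in> set p"
    using Cons that by auto
  with Cons.prems show ?case by (cases "d = e") auto
qed simp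

locale colored_search_tree = dual_search_tree M P for M :: "'d rooted_map" and P +
  fixes s :: "'d set \<Rightarrow> color"
  assumes extends: "extends_coloring M s (Lambda M T.tree_edges)"
    and root_interface: "root_interface_condition M s"
begin

text \<open>
  The forward face at the top of a chord is on its right if the chord is the left forward dart, and
  then it is white; in the other case it is on its left and black.  For a chord from \<open>v\<^sub>0\<close>, which is
  dual to an outer edge other than the root-edge, the sign is the root-interface condition.
\<close>

lemma chord_flow:
  assumes b: "down_chord b"
  shows "white_flow s b \<le> 0"
proof (cases "right_face M b = v\<^sub>0")
  case True
  have "b \<in> v\<^sub>0 - {root_dart M}"
    using b True tree_edgeI[OF root_child] root_face_iff unfolding down_chord_def by auto
  then have "\<not> (s (origin M b) = White \<and> s (target M b) = Black)"
    using root_interface by (simp add: root_interface_condition_def)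
  then show ?thesis
    by (cases "s (origin M b)"; cases "s (target M b)") (simp_all add: vertex_flow_def)
next
  case False
  have bD: "b \<in> darts M" using b by (simp add: down_chord_def)
  then obtain p where p: "P (right_face M b) = Some p"
    using T.parent_exists[OF _ False] by (metis right_face_in_faces vertex_set_dual)
  obtain Q where "spanning_tree M (root_vertex M) Q" "edge_of M ` ran Q = edge_set M - T.tree_edges"
    by (rule complement_spanning_tree)
  then interpret tree_pair M P Q
    by (simp add: tree_pair_def tree_pair_axioms_def dual_search_tree_axioms)
  have "s (target M (rot M p)) = (if b = rot M p then White else Black)"
    using extends chord_forward_face(1)[OF b p False] Lambda_chord[OF b p False]
    by (simp add: extends_coloring_def)
  moreover have "b = rot M p \<or> b = face_perm M (rot M p)"
    using down_chord_forward[OF b p False] by blast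
  ultimately show ?thesis
    using darts_at_child(4)[OF p False bD refl] by (auto simp: vertex_flow_def)
qed

lemma upward_flow:
  assumes e: "e \<in> darts M" "edge_of M e \<notin> T.tree_edges"
    and "T.desc y (right_face M e)" "\<not> T.desc y (right_face M (flip M e))"
  shows "white_flow s e \<ge> 0"
proof -
  have "\<not> down_chord e"
    using assms(3,4) descends_trans unfolding down_chord_def by blast
  then have "down_chord (flip M e)"
    using down_chord_cases[OF e] by blast
  then show ?thesis
    using chord_flow[of "flip M e"] dual.circulation_flip[OF circulation_vertex_flow, of e] e by simp
qed

text \<open>
  What goes through a tree edge goes up again through the chords leaving its subtree.
\<close>

lemma tree_flow:
  assumes "P y = Some d"
  shows "white_flow s d \<ge> 0"
  unfolding T.circulation_subtree[OF circulation_vertex_flow assms]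
proof (rule sum_nonneg)
  fix e assume "e \<in> {e \<in> darts (dual M). T.desc y (origin (dual M) e) \<and>
    \<not> T.desc y (target (dual M) e) \<and> edge_of (dual M) e \<notin> edge_of (dual M) ` ran P}"
  then show "white_flow s e \<ge> 0"
    using upward_flow[of e y] by simp
qed

text \<open>
  At the top of a bicolored chord the interface comes up along the chord.  It cannot leave upward
  along the parent edge, so it goes down again: no interface edge leaves the subtree.
\<close>

lemma chord_confines_interface:
  assumes b: "down_chord b" and v: "right_face M b \<noteq> v\<^sub>0" and bic: "white_flow s b \<noteq> 0"
  shows "\<And>p. P (right_face M b) = Some p \<Longrightarrow> white_flow s p = 0"
    and "\<And>e. e \<in> darts M \<Longrightarrow> white_flow s e \<noteq> 0 \<Longrightarrow>
      T.desc (right_face M b) (right_face M e) \<longleftrightarrow> T.desc (right_face M b) (right_face M (flip M e))"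
proof -
  let ?v = "right_face M b"
  have bD: "b \<in> darts M" using b by (simp add: down_chord_def)
  then obtain p where p: "P ?v = Some p"
    using T.parent_exists[OF _ v] by (metis right_face_in_faces vertex_set_dual)
  note at_v = darts_at_child[OF p v]
  obtain d where d: "P (right_face M (flip M d)) = Some d" "right_face M d = right_face M b"
    "b = rot M p \<and> d = face_perm M (rot M p) \<or> b = face_perm M (rot M p) \<and> d = rot M p"
    using down_chord_forward[OF b p v] by metis
  have pD: "p \<in> darts M" "right_face M (flip M p) = ?v"
    using parent_dart[OF p] parent_target[OF p] by auto
  have "{e \<in> darts (dual M). origin (dual M) e = ?v} = {flip M p, b, d}"
    (is "?L = ?R")
  proof (intro equalityI subsetI)
    fix e assume "e \<in> ?L"
    then have "e = flip M p \<or> e = rot M p \<or> e = face_perm M (rot M p)"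
      by (intro at_v(1)) simp_all
    with d(3) show "e \<in> ?R" by blast
  next
    fix e assume "e \<in> ?R"
    then have "e = flip M p \<or> e = b \<or> e = d" by blast
    then show "e \<in> ?L"
      using d(2) pD bD parent_dart[OF d(1)] by (elim disjE) simp_all
  qed
  moreover have "?v \<in> vertex_set (dual M)" using bD by simp
  ultimately have "sum (white_flow s) {flip M p, b, d} = 0"
    using circulation_vertex_flow[of "{v. s v = White}"] unfolding dual.circulation_def by metis
  moreover have "flip M p \<noteq> b" "flip M p \<noteq> d" "b \<noteq> d"
    using at_v(2-4)[OF bD refl] d(3) by metis+
  ultimately have "white_flow s (flip M p) + white_flow s b + white_flow s d = 0"
    by simp
  moreover have "white_flow s (flip M p) = - white_flow s p"
    using dual.circulation_flip[OF circulation_vertex_flow, of p] pD by simp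
  \<comment> \<open>one unit comes up along \<open>b\<close> and at most one goes down along \<open>d\<close>, so none is left for \<open>p\<close>\<close>
  moreover have "white_flow s b < 0"
    using chord_flow[OF b] bic by simp
  moreover have "white_flow s d \<le> 1"
    by (simp add: vertex_flow_def)
  moreover have "white_flow s p \<ge> 0"
    by (rule tree_flow[OF p])
  ultimately have zero: "white_flow s p = 0" by linarith
  then show "white_flow s p' = 0" if "P ?v = Some p'" for p'
    using p that by simp
  have leaving: "white_flow s e = 0"
    if e: "e \<in> darts M" "T.desc ?v (right_face M e)" "\<not> T.desc ?v (right_face M (flip M e))" for e
  proof (cases "edge_of M e \<in> T.tree_edges")
    case True
    then have "P ?v = Some (flip M e)"
      using T.tree_edge_leaving_subtree[of e ?v] e by simp
    then show ?thesis
      using p zero dual.circulation_flip[OF circulation_vertex_flow, of e] e by simp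
  next
    case False
    let ?L = "{e \<in> darts M. T.desc ?v (right_face M e) \<and> \<not> T.desc ?v (right_face M (flip M e)) \<and>
      edge_of M e \<notin> T.tree_edges}"
    have "sum (white_flow s) ?L = 0"
      using T.circulation_subtree[OF circulation_vertex_flow p] zero by simp
    then have "\<forall>e \<in> ?L. white_flow s e = 0"
      using upward_flow by (subst (asm) sum_nonneg_eq_0_iff) auto
    with e False show ?thesis by simp
  qed
  show "T.desc ?v (right_face M e) \<longleftrightarrow> T.desc ?v (right_face M (flip M e))"
    if e: "e \<in> darts M" "white_flow s e \<noteq> 0" for e
    using leaving[of e] leaving[of "flip M e"] e
      dual.circulation_flip[OF circulation_vertex_flow, of e "{v. s v = White}"] by auto
qed

text \<open>
  A connected piece of interface containing a chord stays below the top of this chord.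
\<close>

lemma interface_chord:
  assumes w: "dual.walk (interface_edges M s) u q w" and d: "d \<in> set q" "edge_of M d \<notin> T.tree_edges"
  obtains b where "edge_of M b = edge_of M d" "down_chord b" "right_face M b \<noteq> v\<^sub>0"
    "white_flow s b \<noteq> 0" "T.desc (right_face M b) u"
    "\<And>e. e \<in> set q \<Longrightarrow> T.desc (right_face M b) (right_face M e)"
    "\<And>e. e \<in> set q \<Longrightarrow> T.desc (right_face M b) (right_face M (flip M e))"
proof -
  note int = interface_dart[OF w]
  obtain b where b: "down_chord b" and bd: "b = d \<or> b = flip M d"
    using down_chord_cases[OF int(1)[OF d(1)] d(2)] by blast
  have bic: "white_flow s b \<noteq> 0" and v: "right_face M b \<noteq> v\<^sub>0"
    using bd int[OF d(1)] dual.circulation_flip[OF circulation_vertex_flow, of d "{v. s v = White}"]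
    by auto
  have edge: "edge_of M b = edge_of M d"
    using bd by auto
  let ?K = "\<lambda>x. T.desc (right_face M b) x"
  have K: "?K (right_face M e) \<longleftrightarrow> ?K (right_face M (flip M e))" if "e \<in> set q" for e
    using chord_confines_interface(2)[OF b v bic int(1,2)[OF that]] .
  have within: "?K (right_face M e) \<longleftrightarrow> ?K u" if "e \<in> set q" for e
    using dual.walk_within[OF w, of ?K e] K that by simp
  have "?K (right_face M d)"
    using bd b unfolding down_chord_def by auto
  then have u: "?K u" using within d(1) by blast
  show ?thesis
    by (rule that[OF edge b v bic u]) (use K within u in blast)+
qed

text \<open>
  The path starts at the only child of \<open>v\<^sub>0\<close>, so this would be the top of the chord, and its parent
  edge, the dual of the root-edge, would not be bicolored.
\<close>

lemma percolation_path_in_tree: "percolation_path M s \<subseteq> T.tree_edges"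
proof
  fix f assume "f \<in> percolation_path M s"
  then obtain d q w where f: "f = edge_of M d"
    and w: "dual.walk (interface_edges M s) (right_face M (flip M (root_dart M))) q w"
    and d: "d \<in> set q"
    by (auto simp: percolation_path_def left_face_def)
  show "f \<in> T.tree_edges"
  proof (rule ccontr)
    assume "f \<notin> T.tree_edges"
    then have chord: "edge_of M d \<notin> T.tree_edges" using f by simp
    obtain b where b: "down_chord b" "right_face M b \<noteq> v\<^sub>0" "white_flow s b \<noteq> 0"
      "T.desc (right_face M b) (right_face M (flip M (root_dart M)))"
      using interface_chord[OF w d chord] by metis
    then have "right_face M b = right_face M (flip M (root_dart M))"
      using desc_step_iff[OF root_child, of "right_face M b"] T.desc_root_iff by auto
    then have "white_flow s (root_dart M) = 0"
      using chord_confines_interface(1)[OF b(1-3)] root_child by simp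
    then show False
      using root_interface by (simp add: root_interface_condition_def vertex_flow_def)
  qed
qed

text \<open>
  The tops of two chords of a cycle are below each other, and a triangle is the top of at most one
  chord because one of its forward darts is a tree edge.
\<close>

lemma percolation_cycle_one_chord:
  assumes "C \<in> percolation_cycles M s"
  shows "\<exists>!e. e \<in> C \<and> e \<notin> T.tree_edges"
proof -
  obtain q u where C: "C = edge_of M ` set q"
    and w: "dual.walk (interface_edges M s) u q u" and ne: "q \<noteq> []"
    and dist: "distinct (map (edge_of M) q)"
    using assms by (auto simp: percolation_cycles_def undirected_cycle_def pre_digraph.cycle_def)
  have "\<not> C \<subseteq> T.tree_edges"
    using T.no_closed_trail[OF w ne] dist C by simp
  then obtain f where f: "f \<in> C" "f \<notin> T.tree_edges" by blast
  moreover have "f' = f" if f': "f' \<in> C" "f' \<notin> T.tree_edges" for f'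
  proof -
    obtain d d' where d: "d \<in> set q" "f = edge_of M d" and d': "d' \<in> set q" "f' = edge_of M d'"
      using C f(1) f'(1) by blast
    obtain b where b: "edge_of M b = f" "down_chord b" "right_face M b \<noteq> v\<^sub>0"
      "\<And>e. e \<in> set q \<Longrightarrow> T.desc (right_face M b) (right_face M e)"
      "\<And>e. e \<in> set q \<Longrightarrow> T.desc (right_face M b) (right_face M (flip M e))"
      using interface_chord[OF w d(1)] d(2) f(2) by metis
    obtain b' where b': "edge_of M b' = f'" "down_chord b'" "right_face M b' \<noteq> v\<^sub>0"
      "\<And>e. e \<in> set q \<Longrightarrow> T.desc (right_face M b') (right_face M e)"
      "\<And>e. e \<in> set q \<Longrightarrow> T.desc (right_face M b') (right_face M (flip M e))"
      using interface_chord[OF w d'(1)] d'(2) f'(2) by metis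
    have bd: "d = b \<or> d = flip M b" "d' = b' \<or> d' = flip M b'"
      using b(1) b'(1) d(2) d'(2) by (simp_all add: primal.edge_of_eq_iff)
    have "T.desc (right_face M b) (right_face M b')"
      using bd(2) b(4,5)[OF d'(1)] by auto
    moreover have "T.desc (right_face M b') (right_face M b)"
      using bd(1) b'(4,5)[OF d(1)] by auto
    ultimately have top: "right_face M b' = right_face M b"
      using T.desc_antisym by blast
    have bD: "b \<in> darts M" using b(2) by (simp add: down_chord_def)
    then obtain p where p: "P (right_face M b) = Some p"
      using T.parent_exists[OF _ b(3)] by (metis right_face_in_faces vertex_set_dual)
    then have p': "P (right_face M b') = Some p" using top by simp
    obtain c where c: "P (right_face M (flip M c)) = Some c"
      "b = rot M p \<and> c = face_perm M (rot M p) \<or> b = face_perm M (rot M p) \<and> c = rot M p"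
      using down_chord_forward[OF b(2) p b(3)] by metis
    have "b' = rot M p \<or> b' = face_perm M (rot M p)"
      using down_chord_forward[OF b'(2) p' b'(3)] by metis
    moreover have "b' \<noteq> c"
      using tree_edgeI[OF c(1)] b'(1) f'(2) by auto
    ultimately have "b' = b" using c(2) by auto
    then show ?thesis using b(1) b'(1) by simp
  qed
  ultimately show ?thesis by blast
qed

lemma tree_dart_white_on_left:
  assumes "tree_dart (dual M) T.tree_edges v\<^sub>0 d" "bicolored M s d"
  shows "face_coloring M s (left_face (dual M) d) = White"
proof -
  have "P (target (dual M) d) = Some d"
    using assms(1) T.tree_dart_iff by simp
  then have "white_flow s d \<ge> 0"
    by (rule tree_flow)
  then show ?thesis
    using assms(2) unfolding bicolored_iff left_face_coloring
    by (cases "s (origin M d)") (simp_all add: vertex_flow_def split: if_splits)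
qed

end


section \<open>The map with a single edge\<close>

text \<open>
  The dual is a loop at its only vertex, so the search stops at once with the empty tree, which is
  also the only spanning tree; there are no inner vertices and no interfaces.
\<close>

locale single_edge_map = planar_map M for M :: "'d rooted_map" +
  assumes loopless: "loopless M"
    and single: "single_edge M"
begin

lemma edges: "edge_set M = {root_edge M}"
  using single primal.edge_of_in_edges[OF root_dart_in] unfolding single_edge_def
  by (metis card_1_singletonE singletonD)

lemma darts_cases: "d \<in> darts M \<Longrightarrow> d = root_dart M \<or> d = flip M (root_dart M)"
  using edges primal.edge_of_in_edges[of d] by (simp add: primal.edge_of_eq_iff) (metis map_flip_flip)

lemma rot_root: "rot M (flip M (root_dart M)) = flip M (root_dart M)"
proof -
  have "origin M (root_dart M) \<noteq> origin M (flip M (root_dart M))"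
    using loopless root_dart_in unfolding loopless_def primal.origin_flip by blast
  then have "rot M (flip M (root_dart M)) \<noteq> root_dart M"
    by (metis origin_rot)
  then show ?thesis
    using darts_cases[of "rot M (flip M (root_dart M))"] by simp
qed

lemma one_face: "d \<in> darts M \<Longrightarrow> right_face M d = v\<^sub>0"
proof -
  assume d: "d \<in> darts M"
  have "face_perm M (root_dart M) = flip M (root_dart M)"
    by (simp add: face_perm_def rot_root)
  then have "right_face M (flip M (root_dart M)) = v\<^sub>0"
    using right_face_face_perm[of "root_dart M"] by simp
  then show ?thesis
    using darts_cases[OF d] by metis
qed

lemma no_inner_vertices: "inner_vertices M = {}"
proof -
  have "origin M d \<in> outer_vertices M" if "d \<in> darts M" for d
    using one_face[OF that] that root_face_iff unfolding outer_vertices_def by blast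
  then show ?thesis by (auto simp: inner_vertices_def vertex_set_def)
qed

lemma search_stays:
  assumes "dfs_reaches (dual M) v\<^sub>0 allowed u X P"
  shows "u = v\<^sub>0 \<and> X = {v\<^sub>0} \<and> P = Map.empty"
  using assms
proof induction
  case (forward u X P d)
  then have "d \<in> darts M" "right_face M (flip M d) \<notin> {v\<^sub>0}"
    using dual.forward_dartsD[of d X u] by simp_all
  then show ?case using one_face[of "flip M d"] by simp
qed simp_all

lemma search_trees: "dfs_trees (dual M) v\<^sub>0 allowed = {{}}"
proof -
  have stop: "forward_darts (dual M) {v\<^sub>0} v\<^sub>0 = {}"
  proof (rule equals0I)
    fix d assume "d \<in> forward_darts (dual M) {v\<^sub>0} v\<^sub>0"
    then show False
      using dual.forward_dartsD[of d "{v\<^sub>0}" "v\<^sub>0"] one_face[of "flip M d"] by simp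
  qed
  show ?thesis
  proof (intro equalityI subsetI)
    fix T assume "T \<in> dfs_trees (dual M) v\<^sub>0 allowed"
    then obtain X P where "T = edge_of M ` ran P" "dfs_reaches (dual M) v\<^sub>0 allowed v\<^sub>0 X P"
      by (auto simp: dfs_trees_def)
    then show "T \<in> {{}}" using search_stays by fastforce
  next
    fix T :: "'d set set" assume "T \<in> {{}}"
    moreover have "{} = edge_of (dual M) ` ran (Map.empty :: 'd set \<Rightarrow> 'd option)" by simp
    ultimately show "T \<in> dfs_trees (dual M) v\<^sub>0 allowed"
      using stop dfs_reaches.start[of "dual M" "v\<^sub>0" allowed] unfolding dfs_trees_def by blast
  qed
qed

lemma Delta_single: "Delta M c = {}"
  by (simp add: Delta_def search_trees)

lemma walk_in_empty: "dual.walk {} u p v \<Longrightarrow> p = []"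
  by (cases p) auto

lemma dual_spanning_trees: "spanning_tree_of (dual M) T \<longleftrightarrow> T = {}"
proof
  assume T: "spanning_tree_of (dual M) T"
  then have "T \<subseteq> {edge_of M (root_dart M)}"
    using edges by (simp add: spanning_tree_of_def)
  moreover have "edge_of M (root_dart M) \<notin> T"
  proof
    assume "edge_of M (root_dart M) \<in> T"
    then have "dual.walk T v\<^sub>0 [root_dart M] v\<^sub>0"
      using one_face[of "flip M (root_dart M)"] by simp
    then have "undirected_cycle (dual M) T [root_dart M]"
      unfolding undirected_cycle_def pre_digraph.cycle_def by (intro conjI exI[of _ "v\<^sub>0"]) simp_all
    with T show False by (simp add: spanning_tree_of_def)
  qed
  ultimately show "T = {}" by blast
next
  assume T: "T = {}"
  have "right_face M ` darts M = {v\<^sub>0}"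
  proof (intro equalityI subsetI)
    fix f assume "f \<in> right_face M ` darts M"
    then obtain d where "d \<in> darts M" "f = right_face M d" by (rule imageE)
    with one_face[of d] show "f \<in> {v\<^sub>0}" by simp
  qed (use root_dart_in in simp)
  then have "vertex_set (dual M) = {v\<^sub>0}"
    by (simp add: face_set_def)
  then have "strongly_connected (edge_graph (dual M) T)"
    by (auto simp: strongly_connected_def edge_graph_def reachable_def)
  moreover have "\<not> undirected_cycle (dual M) T p" for p
    using walk_in_empty T by (auto simp: undirected_cycle_def pre_digraph.cycle_def)
  ultimately show "spanning_tree_of (dual M) T"
    using T by (simp add: spanning_tree_of_def)
qed

lemma DFS_single: "DFS M = {{}}"
proof -
  have "DFS M = Collect (spanning_tree_of (dual M))"
    using single by (simp add: DFS_def)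
  also have "\<dots> = {{}}"
    using dual_spanning_trees by blast
  finally show ?thesis .
qed

lemma Perc_single: "Perc M = {\<lambda>_. undefined}"
  by (simp add: Perc_def no_inner_vertices)

lemma Lambda_single: "Lambda M T = (\<lambda>_. undefined)"
  by (simp add: Lambda_def no_inner_vertices fun_eq_iff)

lemma no_interface_edges: "interface_edges M s = {}"
  using one_face unfolding interface_edges_def origin_dual_eq dual_simps by blast

lemma no_percolation_path: "percolation_path M s = {}"
proof -
  have "q = []" if "dual.walk (interface_edges M s) u q w" for u q w
    using walk_in_empty that unfolding no_interface_edges .
  then have "d \<notin> set q" if "dual.walk (interface_edges M s) u q w" for u q w d
    using that by fastforce
  then show ?thesis unfolding percolation_path_def by blast
qed

lemma no_percolation_cycles: "percolation_cycles M s = {}"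
proof -
  have "\<not> undirected_cycle (dual M) (interface_edges M s) q" for q
    using walk_in_empty unfolding no_interface_edges undirected_cycle_def pre_digraph.cycle_def by blast
  then show ?thesis unfolding percolation_cycles_def by blast
qed

lemma no_tree_darts: "\<not> tree_dart (dual M) {} r d"
proof -
  have "\<not> dual.walk {} r (p @ [d]) v" for p v
    using walk_in_empty by blast
  then show ?thesis unfolding tree_dart_def pre_digraph.apath_def by blast
qed

end


section \<open>The bijection and its interfaces\<close>

theorem theorem4p8:
  fixes M :: "'d rooted_map"
  assumes "class_T M"
  shows "bij_betw (Delta M) (Perc M) (DFS M) \<and>
    bij_betw (Lambda M) (DFS M) (Perc M) \<and>
    (\<forall>c \<in> Perc M. Lambda M (Delta M c) = c) \<and>
    (\<forall>T \<in> DFS M. Delta M (Lambda M T) = T) \<and>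
    (\<forall>c \<in> Perc M. \<forall>s \<in> site_configurations M.
      extends_coloring M s c \<and> root_interface_condition M s \<longrightarrow>
        percolation_path M s \<subseteq> Delta M c \<and>
        (\<forall>C \<in> percolation_cycles M s. \<exists>!e. e \<in> C \<and> e \<notin> Delta M c) \<and>
        (\<forall>d. tree_dart (dual M) (Delta M c) (root_vertex (dual M)) d \<and> bicolored M s d \<longrightarrow>
          face_coloring M s (left_face (dual M) d) = White))"
proof (cases "single_edge M")
  case True
  interpret single_edge_map M
    using assms True by unfold_locales (auto simp: class_T_def)
  show ?thesis
    unfolding DFS_single Perc_single no_percolation_path no_percolation_cycles Delta_single
    using no_tree_darts by (simp add: bij_betw_def Delta_single Lambda_single)
next
  case False
  interpret boundary_triangulation M
    using assms False by unfold_locales (auto simp: class_T_def)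
  have interface: "percolation_path M s \<subseteq> Delta M c \<and>
      (\<forall>C \<in> percolation_cycles M s. \<exists>!e. e \<in> C \<and> e \<notin> Delta M c) \<and>
      (\<forall>d. tree_dart (dual M) (Delta M c) (root_vertex (dual M)) d \<and> bicolored M s d \<longrightarrow>
        face_coloring M s (left_face (dual M) d) = White)"
    if c: "c \<in> Perc M" and s: "extends_coloring M s c" "root_interface_condition M s" for c s
  proof -
    obtain P where P: "dual_search_tree M P" and T: "Delta M c = edge_of M ` ran P"
      using Delta_search_tree[OF c] .
    interpret dual_search_tree M P by (rule P)
    have "Lambda M T.tree_edges = c"
      using Lambda_Delta[OF c] T by simp
    with s interpret colored_search_tree M P s
      by unfold_locales simp_all
    have D: "Delta M c = T.tree_edges" using T by simp
    show ?thesis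
      unfolding D using percolation_path_in_tree percolation_cycle_one_chord tree_dart_white_on_left
      by simp
  qed
  show ?thesis
  proof (intro conjI)
    show "\<forall>c \<in> Perc M. Lambda M (Delta M c) = c"
      using Lambda_Delta by blast
    show "bij_betw (Delta M) (Perc M) (DFS M)" "bij_betw (Lambda M) (DFS M) (Perc M)"
      "\<forall>T \<in> DFS M. Delta M (Lambda M T) = T"
      using bijections[OF False] by simp_all
  qed (intro ballI impI, elim conjE, rule interface)
qed

end
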